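(* The position operator $X$ on $L^2(\mathbb{R},\mathbb{H})$ is equivalent to the operator $\frac{1}{\sqrt2}(\partial_S+q)$ on the space $\mathcal{F}^{2,1}_{Slice}(\mathbb{H})$ via the quaternionic Segal-Bargmann transform $\mathcal{B}^S_{\mathbb{H}}$. In other words, for all $\varphi\in\mathcal{D}(X)$, $$X(\varphi)=(\mathcal{B}^S_{\mathbb{H}})^{-1}\,\frac{(\partial_S+q)}{\sqrt2}\,\mathcal{B}^S_{\mathbb{H}}(\varphi).$$
   Context: $\mathbb{H}$ is the algebra of real quaternions, $\mathbb{S}=\{q\in\mathbb{H}:q^2=-1\}$, $\mathbb{C}_I=\mathbb{R}+\mathbb{R}I$ for $I\in\mathbb{S}$. $L^2(\mathbb{R},\mathbb{H})$ is the space of square integrable $\mathbb{H}$-valued functions on $\mathbb{R}$. The position operator is $X\varphi(x)=x\varphi(x)$ with domain $\mathcal{D}(X)=\{\varphi\in L^2(\mathbb{R},\mathbb{H}):X\varphi\in L^2(\mathbb{R},\mathbb{H})\}$. A function $f:\mathbb{H}\to\mathbb{H}$ is (left) slice regular if, for each $I\in\mathbb{S}$, its restriction $f_I$ to $\mathbb{C}_I$ has continuous partial derivatives and satisfies $\frac12\left(\frac{\partial}{\partial x}+I\frac{\partial}{\partial y}\right)f_I(x+Iy)=0$. Its slice derivative $\partial_Sf$ is given on each $\mathbb{C}_I$ by $\frac12\left(\frac{\partial}{\partial x}-I\frac{\partial}{\partial y}\right)f_I(x+Iy)$. The operator $\partial_S+q$ acts by $f\mapsto\partial_Sf(q)+qf(q)$.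 $\mathcal{F}^{2,1}_{Slice}(\mathbb{H})$ is the space of slice regular $f:\mathbb{H}\to\mathbb{H}$ with $\int_{\mathbb{C}_I}|f_I(p)|^2e^{-|p|^2}d\lambda_I(p)<\infty$, where $d\lambda_I(p)=dx\,dy$ for $p=x+yI$; it is independent of the choice of $I\in\mathbb{S}$. The quaternionic Segal-Bargmann transform (with parameter $\nu=1$) is $$\mathcal{B}^S_{\mathbb{H}}(\varphi)(q)=\int_{\mathbb{R}}\mathcal{A}^S_{\mathbb{H}}(q,x)\varphi(x)\,dx,\qquad \mathcal{A}^S_{\mathbb{H}}(q,x)=\pi^{-3/4}e^{-\frac12(q^2+x^2)+\sqrt2\,qx};$$ it is a known fact that it is an isometric bijection from $L^2(\mathbb{R},\mathbb{H})$ onto $\mathcal{F}^{2,1}_{Slice}(\mathbb{H})$. *)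

theory Defs
  imports "HOL-Analysis.Analysis"
begin

section \<open>Real quaternions\<close>

datatype quat = Quat (qRe: real) (qI: real) (qJ: real) (qK: real)

lemma quat_eq_iff: "p = q \<longleftrightarrow> qRe p = qRe q \<and> qI p = qI q \<and> qJ p = qJ q \<and> qK p = qK q"
  by (cases p; cases q) auto

instantiation quat :: ab_group_add
begin
definition "0 = Quat 0 0 0 0"
definition "p + q = Quat (qRe p + qRe q) (qI p + qI q) (qJ p + qJ q) (qK p + qK q)"
definition "- p = Quat (- qRe p) (- qI p) (- qJ p) (- qK p)"
definition "p - q = Quat (qRe p - qRe q) (qI p - qI q) (qJ p - qJ q) (qK p - qK q)"
instance
  by standard
    (auto simp: zero_quat_def plus_quat_def uminus_quat_def minus_quat_def quat_eq_iff)
end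

instantiation quat :: real_vector
begin
definition "scaleR r q = Quat (r * qRe q) (r * qI q) (r * qJ q) (r * qK q)" for r :: real
instance
  by standard (auto simp: scaleR_quat_def plus_quat_def quat_eq_iff algebra_simps)
end

lemma quat_zero_sel [simp]: "qRe 0 = 0" "qI 0 = 0" "qJ 0 = 0" "qK 0 = 0"
  by (simp_all add: zero_quat_def)

lemma quat_add_sel [simp]:
  "qRe (p + q) = qRe p + qRe q" "qI (p + q) = qI p + qI q"
  "qJ (p + q) = qJ p + qJ q" "qK (p + q) = qK p + qK q"
  by (simp_all add: plus_quat_def)

lemma quat_uminus_sel [simp]:
  "qRe (- p) = - qRe p" "qI (- p) = - qI p" "qJ (- p) = - qJ p" "qK (- p) = - qK p"
  by (simp_all add: uminus_quat_def)

lemma quat_diff_sel [simp]: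
  "qRe (p - q) = qRe p - qRe q" "qI (p - q) = qI p - qI q"
  "qJ (p - q) = qJ p - qJ q" "qK (p - q) = qK p - qK q"
  by (simp_all add: minus_quat_def)

lemma quat_scaleR_sel [simp]:
  "qRe (r *\<^sub>R q) = r * qRe q" "qI (r *\<^sub>R q) = r * qI q"
  "qJ (r *\<^sub>R q) = r * qJ q" "qK (r *\<^sub>R q) = r * qK q"
  by (simp_all add: scaleR_quat_def)

instantiation quat :: ring_1
begin
definition "1 = Quat 1 0 0 0"
definition "p * q = Quat
   (qRe p * qRe q - qI p * qI q - qJ p * qJ q - qK p * qK q)
   (qRe p * qI q + qI p * qRe q + qJ p * qK q - qK p * qJ q)
   (qRe p * qJ q - qI p * qK q + qJ p * qRe q + qK p * qI q)
   (qRe p * qK q + qI p * qJ q - qJ p * qI q + qK p * qRe q)"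
instance
  by standard
    (auto simp: one_quat_def times_quat_def quat_eq_iff algebra_simps)
end

lemma quat_one_sel [simp]: "qRe 1 = 1" "qI 1 = 0" "qJ 1 = 0" "qK 1 = 0"
  by (simp_all add: one_quat_def)

lemma quat_mult_sel [simp]:
  "qRe (p * q) = qRe p * qRe q - qI p * qI q - qJ p * qJ q - qK p * qK q"
  "qI (p * q) = qRe p * qI q + qI p * qRe q + qJ p * qK q - qK p * qJ q"
  "qJ (p * q) = qRe p * qJ q - qI p * qK q + qJ p * qRe q + qK p * qI q"
  "qK (p * q) = qRe p * qK q + qI p * qJ q - qJ p * qI q + qK p * qRe q"
  by (simp_all add: times_quat_def)

instance quat :: real_algebra_1
  by standard (auto simp: quat_eq_iff algebra_simps)

lemma quat_of_real_sel [simp]: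
  "qRe (of_real r) = r" "qI (of_real r) = 0" "qJ (of_real r) = 0" "qK (of_real r) = 0"
  by (simp_all add: of_real_def)

instantiation quat :: real_inner
begin
definition "inner p q = qRe p * qRe q + qI p * qI q + qJ p * qJ q + qK p * qK q"
definition "norm q = sqrt ((qRe q)\<^sup>2 + (qI q)\<^sup>2 + (qJ q)\<^sup>2 + (qK q)\<^sup>2)"
definition "sgn q = q /\<^sub>R norm q" for q :: quat
definition "dist p q = norm (p - q)" for p q :: quat
definition "(uniformity :: (quat \<times> quat) filter) =
  (INF e\<in>{0<..}. principal {(p, q). dist p q < e})"
definition "open (U :: quat set) \<longleftrightarrow>
  (\<forall>p\<in>U. \<forall>\<^sub>F (p', q) in uniformity. p' = p \<longrightarrow> q \<in> U)"
instance
proof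
  fix p q r :: quat and c :: real
  show "inner p q = inner q p"
    by (simp add: inner_quat_def algebra_simps)
  show "inner (p + q) r = inner p r + inner q r" "inner (c *\<^sub>R p) q = c * inner p q"
    by (simp_all add: inner_quat_def algebra_simps)
  show "0 \<le> inner p p"
    by (simp add: inner_quat_def)
  show "inner p p = 0 \<longleftrightarrow> p = 0"
    unfolding inner_quat_def quat_eq_iff
    by (auto simp: add_nonneg_eq_0_iff)
  show "norm p = sqrt (inner p p)"
    by (simp add: inner_quat_def norm_quat_def power2_eq_square)
qed (simp_all add: sgn_quat_def dist_quat_def uniformity_quat_def open_quat_def)
end

instantiation quat :: real_normed_div_algebra
begin
definition "inverse q = (Quat (qRe q) (- qI q) (- qJ q) (- qK q)) /\<^sub>R (norm q)\<^sup>2"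
definition "p div q = p * inverse q" for p q :: quat
instance
proof
  fix p q :: quat
  show "norm (p * q) = norm p * norm q"
    unfolding norm_quat_def real_sqrt_mult [symmetric]
    by (simp add: power2_eq_square algebra_simps)
  have n: "(norm p)\<^sup>2 = (qRe p)\<^sup>2 + (qI p)\<^sup>2 + (qJ p)\<^sup>2 + (qK p)\<^sup>2" for p :: quat
    unfolding norm_quat_def by simp
  show "inverse p * p = 1" if "p \<noteq> 0"
  proof -
    have "(norm p)\<^sup>2 \<noteq> 0" using that by simp
    then show ?thesis
      unfolding inverse_quat_def n quat_eq_iff
      by (simp add: divide_simps) (simp add: power2_eq_square algebra_simps)
  qed
  show "p * inverse p = 1" if "p \<noteq> 0"
  proof -
    have "(norm p)\<^sup>2 \<noteq> 0" using that by simp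
    then show ?thesis
      unfolding inverse_quat_def n quat_eq_iff
      by (simp add: divide_simps) (simp add: power2_eq_square algebra_simps)
  qed
  show "p div q = p * inverse q"
    by (rule divide_quat_def)
  show "inverse (0::quat) = 0"
    by (simp add: inverse_quat_def quat_eq_iff)
qed
end

instantiation quat :: euclidean_space
begin
definition "Basis = {Quat 1 0 0 0, Quat 0 1 0 0, Quat 0 0 1 0, Quat 0 0 0 1}"
instance
proof
  fix u v :: quat
  show "(Basis :: quat set) \<noteq> {}" "finite (Basis :: quat set)"
    by (simp_all add: Basis_quat_def)
  show "inner u v = (if u = v then 1 else 0)" if "u \<in> Basis" "v \<in> Basis"
    using that unfolding Basis_quat_def by (elim insertE emptyE) (simp_all add: inner_quat_def)
  show "(\<forall>v\<in>Basis. inner u v = 0) \<longleftrightarrow> u = 0"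
    by (cases u) (simp add: Basis_quat_def inner_quat_def zero_quat_def)
qed
end

section \<open>Slice regular functions and the slice Fock space\<close>

definition imag_units :: "quat set" where
  "imag_units = {q. q\<^sup>2 = -1}"

definition slice_pt :: "quat \<Rightarrow> real \<Rightarrow> real \<Rightarrow> quat" where
  "slice_pt I x y = of_real x + of_real y * I"

definition slice_dx :: "(quat \<Rightarrow> quat) \<Rightarrow> quat \<Rightarrow> real \<Rightarrow> real \<Rightarrow> quat" where
  "slice_dx f I x y = vector_derivative (\<lambda>t. f (slice_pt I t y)) (at x)"

definition slice_dy :: "(quat \<Rightarrow> quat) \<Rightarrow> quat \<Rightarrow> real \<Rightarrow> real \<Rightarrow> quat" where
  "slice_dy f I x y = vector_derivative (\<lambda>t. f (slice_pt I x t)) (at y)"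

definition slice_regular :: "(quat \<Rightarrow> quat) \<Rightarrow> bool" where
  "slice_regular f \<longleftrightarrow> (\<forall>I\<in>imag_units.
     (\<forall>x y. (\<lambda>t. f (slice_pt I t y)) differentiable (at x)) \<and>
     (\<forall>x y. (\<lambda>t. f (slice_pt I x t)) differentiable (at y)) \<and>
     continuous_on UNIV (\<lambda>(x, y). slice_dx f I x y) \<and>
     continuous_on UNIV (\<lambda>(x, y). slice_dy f I x y) \<and>
     (\<forall>x y. (1/2) *\<^sub>R (slice_dx f I x y + I * slice_dy f I x y) = 0))"

text \<open>Each quaternion lies on at least one slice, and a real one lies on all of them. The
  description below picks the common value of the slicewise derivatives; that it exists for
  slice regular functions is \<open>slice_deriv_eq\<close>.\<close>

definition slice_deriv :: "(quat \<Rightarrow> quat) \<Rightarrow> quat \<Rightarrow> quat" where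
  "slice_deriv f q = (THE d. \<forall>I\<in>imag_units. \<forall>x y. q = slice_pt I x y \<longrightarrow>
     d = (1/2) *\<^sub>R (slice_dx f I x y - I * slice_dy f I x y))"

lemma imag_units_iff:
  "I \<in> imag_units \<longleftrightarrow> qRe I = 0 \<and> (qI I)\<^sup>2 + (qJ I)\<^sup>2 + (qK I)\<^sup>2 = 1"
proof
  assume "I \<in> imag_units"
  then have e: "(qRe I)\<^sup>2 - (qI I)\<^sup>2 - (qJ I)\<^sup>2 - (qK I)\<^sup>2 = -1"
      "qRe I * qI I = 0" "qRe I * qJ I = 0" "qRe I * qK I = 0"
    by (auto simp: imag_units_def power2_eq_square quat_eq_iff algebra_simps)
  have "qRe I = 0"
  proof (rule ccontr)
    assume "qRe I \<noteq> 0"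
    with e have "(qRe I)\<^sup>2 = -1" by simp
    then show False using zero_le_power2 [of "qRe I"] by linarith
  qed
  with e show "qRe I = 0 \<and> (qI I)\<^sup>2 + (qJ I)\<^sup>2 + (qK I)\<^sup>2 = 1" by simp
qed (auto simp: imag_units_def power2_eq_square quat_eq_iff algebra_simps)

lemma slice_pt_sel [simp]:
  assumes "I \<in> imag_units"
  shows "qRe (slice_pt I x y) = x" "qI (slice_pt I x y) = y * qI I"
    "qJ (slice_pt I x y) = y * qJ I" "qK (slice_pt I x y) = y * qK I"
  using assms by (auto simp: slice_pt_def imag_units_iff)

lemma slice_pt_eq_cases:
  assumes "I \<in> imag_units" "J \<in> imag_units" "slice_pt I x y = slice_pt J u v"
  obtains "u = x" "y = 0" "v = 0" | "u = x" "J = I" "v = y" | "u = x" "J = - I" "v = - y"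
proof -
  have *: "u = x" "y * qI I = v * qI J" "y * qJ I = v * qJ J" "y * qK I = v * qK J"
    using assms(3) unfolding quat_eq_iff by (auto simp: assms(1,2))
  have "y\<^sup>2 = y\<^sup>2 * ((qI I)\<^sup>2 + (qJ I)\<^sup>2 + (qK I)\<^sup>2)"
    using assms(1) by (simp add: imag_units_iff)
  also have "\<dots> = (y * qI I)\<^sup>2 + (y * qJ I)\<^sup>2 + (y * qK I)\<^sup>2"
    by (simp add: algebra_simps)
  also have "\<dots> = v\<^sup>2 * ((qI J)\<^sup>2 + (qJ J)\<^sup>2 + (qK J)\<^sup>2)"
    unfolding * by (simp add: algebra_simps)
  also have "\<dots> = v\<^sup>2"
    using assms(2) by (simp add: imag_units_iff)
  finally have "v = y \<or> v = - y"
    by (metis power2_eq_iff)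
  then consider "y = 0" "v = 0" | "y \<noteq> 0" "v = y" | "y \<noteq> 0" "v = - y" by force
  then show ?thesis
  proof cases
    case 1
    then show ?thesis using * that by blast
  next
    case 2
    then have "J = I" using * assms(1,2) by (simp add: quat_eq_iff imag_units_iff)
    then show ?thesis using * 2 that by blast
  next
    case 3
    have "qI I = - qI J" "qJ I = - qJ J" "qK I = - qK J"
      using *(2-4) 3 by (metis mult_cancel_left mult_minus_left mult_minus_right)+
    then have "J = - I" using assms(1,2) by (simp add: quat_eq_iff imag_units_iff)
    then show ?thesis using * 3 that by blast
  qed
qed

lemma slice_pt_ex: "\<exists>I\<in>imag_units. \<exists>x y. q = slice_pt I x y"
proof (cases "qI q = 0 \<and> qJ q = 0 \<and> qK q = 0")
  case True
  have "Quat 0 1 0 0 \<in> imag_units" by (simp add: imag_units_iff)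
  moreover from this have "q = slice_pt (Quat 0 1 0 0) (qRe q) 0"
    using True by (auto simp: quat_eq_iff)
  ultimately show ?thesis by blast
next
  case False
  define y where "y = sqrt ((qI q)\<^sup>2 + (qJ q)\<^sup>2 + (qK q)\<^sup>2)"
  have y2: "y\<^sup>2 = (qI q)\<^sup>2 + (qJ q)\<^sup>2 + (qK q)\<^sup>2" by (simp add: y_def)
  have "(qI q)\<^sup>2 + (qJ q)\<^sup>2 + (qK q)\<^sup>2 \<noteq> 0"
    using False by (auto simp: add_nonneg_eq_0_iff)
  then have y: "y \<noteq> 0" using y2 by auto
  let ?I = "Quat 0 (qI q / y) (qJ q / y) (qK q / y)"
  have "?I \<in> imag_units"
    using y by (simp add: imag_units_iff power_divide flip: add_divide_distrib y2)
  moreover from this have "q = slice_pt ?I (qRe q) y"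
    using y by (auto simp: quat_eq_iff)
  ultimately show ?thesis by blast
qed

lemma slice_deriv_eq:
  assumes f: "slice_regular f" and I: "I \<in> imag_units"
  shows "slice_deriv f (slice_pt I x y) = (1/2) *\<^sub>R (slice_dx f I x y - I * slice_dy f I x y)"
proof -
  have cr: "slice_dx f J u v = - (J * slice_dy f J u v)" if "J \<in> imag_units" for J u v
    using f that unfolding slice_regular_def by (simp add: eq_neg_iff_add_eq_0)
  have dx: "(1/2) *\<^sub>R (slice_dx f J u v - J * slice_dy f J u v) = slice_dx f J u v"
    if "J \<in> imag_units" for J u v
    using cr [OF that, of u v] by (simp add: quat_eq_iff)
  have "slice_dx f J u v = slice_dx f I x y"
    if J: "J \<in> imag_units" and eq: "slice_pt I x y = slice_pt J u v" for J u v
    using I J eq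
    by (rule slice_pt_eq_cases) (auto simp: slice_dx_def slice_pt_def)
  then show ?thesis
    unfolding slice_deriv_def using I dx by (intro the_equality) metis+
qed

text \<open>For slice regular \<open>f\<close> the integrability condition does not depend on the slice; it is
  imposed here on all slices rather than on a chosen one.\<close>

definition slice_fock :: "(quat \<Rightarrow> quat) set" where
  "slice_fock = {f. slice_regular f \<and> (\<forall>I\<in>imag_units.
     integrable lborel (\<lambda>(x, y). (norm (f (slice_pt I x y)))\<^sup>2 * exp (- (norm (slice_pt I x y))\<^sup>2)))}"

definition slice_deriv_plus_mult :: "(quat \<Rightarrow> quat) \<Rightarrow> quat \<Rightarrow> quat" where
  "slice_deriv_plus_mult f q = slice_deriv f q + q * f q"

section \<open>The space of square integrable functions\<close>

definition square_integrable :: "(real \<Rightarrow> quat) \<Rightarrow> bool" where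
  "square_integrable \<phi> \<longleftrightarrow>
     \<phi> \<in> borel_measurable lborel \<and> integrable lborel (\<lambda>x. (norm (\<phi> x))\<^sup>2)"

definition L2_rel :: "(real \<Rightarrow> quat) \<Rightarrow> (real \<Rightarrow> quat) \<Rightarrow> bool" where
  "L2_rel \<phi> \<psi> \<longleftrightarrow>
     square_integrable \<phi> \<and> square_integrable \<psi> \<and> (AE x in lborel. \<phi> x = \<psi> x)"

lemma L2_rel_part_equivp: "part_equivp L2_rel"
proof (rule part_equivpI)
  show "\<exists>\<phi>. L2_rel \<phi> \<phi>"
    by (rule exI [of _ "\<lambda>_. 0"]) (simp add: L2_rel_def square_integrable_def)
  show "symp L2_rel"
    by (rule sympI) (auto simp: L2_rel_def elim!: eventually_mono)
  show "transp L2_rel"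
    by (rule transpI) (auto simp: L2_rel_def elim: eventually_elim2)
qed

quotient_type L2 = "real \<Rightarrow> quat" / partial: L2_rel
  by (rule L2_rel_part_equivp)

lemma L2_rel_square_integrable_iff:
  assumes r: "L2_rel \<phi> \<psi>"
  shows "square_integrable (\<lambda>x. x *\<^sub>R \<phi> x) = square_integrable (\<lambda>x. x *\<^sub>R \<psi> x)"
proof -
  have [measurable]: "\<phi> \<in> borel_measurable borel" "\<psi> \<in> borel_measurable borel"
    using r by (auto simp: L2_rel_def square_integrable_def)
  have "integrable lborel (\<lambda>x. (norm (x *\<^sub>R \<phi> x))\<^sup>2) =
      integrable lborel (\<lambda>x. (norm (x *\<^sub>R \<psi> x))\<^sup>2)"
    by (rule integrable_cong_AE) (use r in \<open>auto simp: L2_rel_def elim!: eventually_mono\<close>)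
  then show ?thesis by (simp add: square_integrable_def)
qed

lift_definition in_dom_X :: "L2 \<Rightarrow> bool" is "\<lambda>\<phi>. square_integrable (\<lambda>x. x *\<^sub>R \<phi> x)"
  by (rule L2_rel_square_integrable_iff)

definition dom_X :: "L2 set" where
  "dom_X = {\<phi>. in_dom_X \<phi>}"

text \<open>The position operator is extended by zero outside its domain \<^const>\<open>dom_X\<close>.\<close>

lift_definition position_op :: "L2 \<Rightarrow> L2" is
  "\<lambda>\<phi>. if square_integrable (\<lambda>x. x *\<^sub>R \<phi> x) then (\<lambda>x. x *\<^sub>R \<phi> x) else (\<lambda>_. 0)"
proof -
  fix \<phi> \<psi> assume r: "L2_rel \<phi> \<psi>"
  have "square_integrable (\<lambda>x. x *\<^sub>R \<phi> x) = square_integrable (\<lambda>x. x *\<^sub>R \<psi> x)"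
    by (rule L2_rel_square_integrable_iff [OF r])
  then show "L2_rel
      (if square_integrable (\<lambda>x. x *\<^sub>R \<phi> x) then (\<lambda>x. x *\<^sub>R \<phi> x) else (\<lambda>_. 0))
      (if square_integrable (\<lambda>x. x *\<^sub>R \<psi> x) then (\<lambda>x. x *\<^sub>R \<psi> x) else (\<lambda>_. 0))"
    using r by (auto simp: L2_rel_def square_integrable_def elim!: eventually_mono)
qed

section \<open>The quaternionic Segal-Bargmann transform\<close>

definition SB_kernel :: "quat \<Rightarrow> real \<Rightarrow> quat" where
  "SB_kernel q x =
     (pi powr (-3/4)) *\<^sub>R exp ((-1/2) *\<^sub>R (q\<^sup>2 + of_real (x\<^sup>2)) + (sqrt 2 * x) *\<^sub>R q)"

lemma continuous_SB_kernel: "continuous_on UNIV (SB_kernel q)"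
proof -
  have *: "continuous_on UNIV (\<lambda>x. exp (x *\<^sub>R p))" for p :: quat
    by (rule continuous_at_imp_continuous_on)
      (auto intro: has_vector_derivative_continuous exp_scaleR_has_vector_derivative_right)
  have comm: "of_real r * p = p * of_real r" for r and p :: quat
    by (simp add: scaleR_conv_of_real [symmetric] of_real_def)
  have "SB_kernel q x = (pi powr (-3/4)) *\<^sub>R
      (exp ((-1/2) *\<^sub>R q\<^sup>2) * of_real (exp (- x\<^sup>2 / 2)) * exp (x *\<^sub>R (sqrt 2 *\<^sub>R q)))" for x
  proof -
    have e: "(-1/2) *\<^sub>R (q\<^sup>2 + of_real (x\<^sup>2)) + (sqrt 2 * x) *\<^sub>R q =
        ((-1/2) *\<^sub>R q\<^sup>2 + of_real (- x\<^sup>2 / 2)) + x *\<^sub>R (sqrt 2 *\<^sub>R q)"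
      by (simp add: scaleR_add_right of_real_def mult.commute)
    have c1: "((-1/2) *\<^sub>R q\<^sup>2) * of_real (- x\<^sup>2 / 2) = of_real (- x\<^sup>2 / 2) * ((-1/2) *\<^sub>R q\<^sup>2)"
      by (rule comm [symmetric])
    have c2: "((-1/2) *\<^sub>R q\<^sup>2 + of_real (- x\<^sup>2 / 2)) * (x *\<^sub>R (sqrt 2 *\<^sub>R q)) =
        (x *\<^sub>R (sqrt 2 *\<^sub>R q)) * ((-1/2) *\<^sub>R q\<^sup>2 + of_real (- x\<^sup>2 / 2))"
      by (simp add: distrib_left distrib_right left_diff_distrib
          right_diff_distrib scaleR_right_diff_distrib of_real_def power2_eq_square mult.assoc)
    show ?thesis
      unfolding SB_kernel_def e exp_add_commuting [OF c2] exp_add_commuting [OF c1]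
      by (simp only: exp_of_real minus_divide_left)
  qed
  then have "SB_kernel q = (\<lambda>x. (pi powr (-3/4)) *\<^sub>R
      (exp ((-1/2) *\<^sub>R q\<^sup>2) * of_real (exp (- x\<^sup>2 / 2)) * exp (x *\<^sub>R (sqrt 2 *\<^sub>R q))))" ..
  then show ?thesis
    by (simp only:) (intro continuous_intros *; simp)
qed

lift_definition SB :: "L2 \<Rightarrow> quat \<Rightarrow> quat" is
  "\<lambda>\<phi> q. \<integral>x. SB_kernel q x * \<phi> x \<partial>lborel"
proof
  fix \<phi> \<psi> q assume r: "L2_rel \<phi> \<psi>"
  then have [measurable]: "\<phi> \<in> borel_measurable borel" "\<psi> \<in> borel_measurable borel"
    by (auto simp: L2_rel_def square_integrable_def)
  have [measurable]: "SB_kernel q \<in> borel_measurable borel"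
    by (rule borel_measurable_continuous_onI [OF continuous_SB_kernel])
  show "(\<integral>x. SB_kernel q x * \<phi> x \<partial>lborel) = (\<integral>x. SB_kernel q x * \<psi> x \<partial>lborel)"
    by (rule integral_cong_AE) (use r in \<open>auto simp: L2_rel_def elim!: eventually_mono\<close>)
qed

end

theory Submission
  imports Defs "HOL-Probability.Levy"
begin

text \<open>Let \<open>c\<close> be any of the four real components of \<open>\<phi>\<close>. On each slice the quaternionic transform
  is obtained from the complex Bargmann transforms of these components, which are entire functions
  independent of the slice. Differentiating the kernel under the integral gives
  \<open>F' + z F = sqrt 2 * (transform of x c)\<close> for \<open>F\<close> the transform of \<open>c\<close>, hence
  \<open>(\<partial>\<^sub>S + q) (SB \<phi>) = sqrt 2 * SB (X \<phi>)\<close>. Completing the square in the kernel shows that, up to a factor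
  of modulus \<open>const * exp (\<bar>z\<bar>\<^sup>2 / 2)\<close>, \<open>F (x + i y)\<close> is the Fourier transform at \<open>sqrt 2 * y\<close> of
  \<open>exp (- (t - sqrt 2 * x)\<^sup>2 / 2) * c t\<close>. The inequality half of Plancherel's theorem then puts the
  transform into the Fock space, and uniqueness of characteristic functions gives injectivity.\<close>

section \<open>Fourier transforms of real functions\<close>

text \<open>The Bochner integral takes the value 0 where \<open>f\<close> is not integrable, which
  makes the bound trivial there; so norms can be moved inside iterated integrals without side
  conditions.\<close>

lemma ennreal_norm_integral_le:
  fixes f :: "'a \<Rightarrow> 'b::{banach, second_countable_topology}"
  shows "ennreal (norm (\<integral>x. f x \<partial>M)) \<le> (\<integral>\<^sup>+x. norm (f x) \<partial>M)"
  by (cases "integrable M f") (auto intro: integral_norm_bound_ennreal simp: not_integrable_integral_eq)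

text \<open>Licenses the exchanges of integrals in the Bessel estimate: a tensor product of
  integrable functions is integrable on the plane, and the phases and transforms multiplied to it
  are bounded.\<close>

lemma integrable_pair_bounded_mult:
  fixes w g :: "real \<Rightarrow> real" and b :: "real \<Rightarrow> real \<Rightarrow> complex"
  assumes w: "integrable lborel w" and g: "integrable lborel g"
    and b: "case_prod b \<in> borel_measurable (lborel \<Otimes>\<^sub>M lborel)" "\<And>x y. norm (b x y) \<le> C"
  shows "integrable (lborel \<Otimes>\<^sub>M lborel) (\<lambda>(x, y). of_real (w x * g y) * b x y)"
proof -
  have [measurable]: "w \<in> borel_measurable borel" "g \<in> borel_measurable borel"
    using w g by auto
  note [measurable] = b(1)
  have C: "0 \<le> C" using b(2)[of 0 0] norm_ge_zero order_trans by blast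
  have "integrable (lborel \<Otimes>\<^sub>M lborel) (\<lambda>(x, y). w x * g y)"
    by (rule lborel_pair.Fubini_integrable) (auto simp: abs_mult w g)
  then have "integrable (lborel \<Otimes>\<^sub>M lborel) (\<lambda>p. C * (case p of (x, y) \<Rightarrow> w x * g y))"
    by simp
  then show ?thesis
  proof (rule Bochner_Integration.integrable_bound)
    have "norm (of_real (w x * g y) * b x y) \<le> norm (C * (w x * g y))" for x y
      using mult_left_mono[OF b(2)[of x y], of "\<bar>w x * g y\<bar>"] C
      by (simp add: norm_mult abs_mult mult.commute mult.left_commute)
    then show "AE p in lborel \<Otimes>\<^sub>M lborel.
        norm (case p of (x, y) \<Rightarrow> of_real (w x * g y) * b x y) \<le> norm (C * (case p of (x, y) \<Rightarrow> w x * g y))"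
      by (intro AE_I2) auto
  qed measurable
qed

section \<open>Gaussian integrals and the Bessel inequality\<close>

lemma integrable_gaussian:
  assumes "0 < n"
  shows "integrable lborel (\<lambda>y. exp (- (y / n)\<^sup>2 / 2) :: real)"
proof -
  have "integrable lborel (\<lambda>y. sqrt (2 * pi * n\<^sup>2) * normal_density 0 n y)"
    using assms by (intro integrable_mult_right integrable_normal_density) auto
  then show ?thesis
    using assms by (simp add: normal_density_def power_divide field_simps)
qed

lemma integral_gaussian:
  assumes "0 < n"
  shows "(\<integral>y. exp (- (y / n)\<^sup>2 / 2) \<partial>lborel) = sqrt (2 * pi) * n"
proof -
  have "(\<integral>y. sqrt (2 * pi * n\<^sup>2) * normal_density 0 n y \<partial>lborel) = sqrt (2 * pi) * n"
    using assms by (simp add: real_sqrt_mult)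
  then show ?thesis
    using assms by (simp add: normal_density_def power_divide mult.commute)
qed

text \<open>Rescaling by \<open>n\<close> reduces this to the characteristic function of the
  standard normal distribution.\<close>

lemma fourier_gaussian:
  assumes n: "0 < n"
  shows "(\<integral>y. of_real (exp (- (y / n)\<^sup>2 / 2)) * iexp (u * y) \<partial>lborel)
    = of_real (sqrt (2 * pi) * n * exp (- (n * u)\<^sup>2 / 2))"
proof -
  have "(\<integral>y. of_real (exp (- (y / n)\<^sup>2 / 2)) * iexp (u * y) \<partial>lborel)
      = n *\<^sub>R (\<integral>y. of_real (exp (- y\<^sup>2 / 2)) * iexp (u * n * y) \<partial>lborel)"
    using n by (subst lborel_integral_real_affine[where c = n and t = 0]) (simp_all add: mult.assoc)
  also have "(\<integral>y. of_real (exp (- y\<^sup>2 / 2)) * iexp (u * n * y) \<partial>lborel)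
      = (\<integral>y. sqrt (2 * pi) *\<^sub>R (std_normal_density y *\<^sub>R iexp (u * n * y)) \<partial>lborel)"
    by (simp add: std_normal_density_def scaleR_conv_of_real)
  also have "\<dots> = sqrt (2 * pi) *\<^sub>R (\<integral>y. std_normal_density y *\<^sub>R iexp (u * n * y) \<partial>lborel)"
    by (rule integral_scaleR_right)
  also have "(\<integral>y. std_normal_density y *\<^sub>R iexp (u * n * y) \<partial>lborel) = char std_normal_distribution (u * n)"
    unfolding char_def by (subst integral_density) (auto simp: normal_density_nonneg)
  finally show ?thesis
    by (simp add: char_std_normal_distribution scaleR_conv_of_real mult_ac)
qed

text \<open>Squaring the Fourier transform and integrating it against a Gaussian weight turns the
  weight into the approximate identity \<open>k\<close> of total mass \<open>2 * pi\<close>.\<close>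

lemma gaussian_weighted_bessel:
  fixes g :: "real \<Rightarrow> real"
  assumes g: "integrable lborel g" and n: "0 < n"
  shows "(\<integral>\<^sup>+y. ennreal (exp (- (y / n)\<^sup>2 / 2) * (cmod (\<integral>t. iexp (y * t) * of_real (g t) \<partial>lborel))\<^sup>2) \<partial>lborel)
    \<le> ennreal (2 * pi) * (\<integral>\<^sup>+t. ennreal ((g t)\<^sup>2) \<partial>lborel)"
proof -
  define w where "w y = exp (- (y / n)\<^sup>2 / 2)" for y :: real
  define k where "k u = sqrt (2 * pi) * n * exp (- (n * u)\<^sup>2 / 2)" for u :: real
  define G where "G y = (\<integral>t. iexp (y * t) * of_real (g t) \<partial>lborel)" for y
  have [measurable]: "g \<in> borel_measurable borel" using g by auto
  have [measurable]: "w \<in> borel_measurable borel" "k \<in> borel_measurable borel"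
    unfolding w_def k_def by measurable
  have [measurable]: "G \<in> borel_measurable borel"
    unfolding G_def by measurable
  have [measurable]: "cnj \<in> borel_measurable borel"
    by (intro borel_measurable_continuous_onI continuous_intros)
  have w: "integrable lborel w" "\<And>y. 0 \<le> w y"
    unfolding w_def by (rule integrable_gaussian[OF n]) auto
  have k0: "0 \<le> k u" for u using n by (simp add: k_def)
  have cnjG: "cnj (G y) = (\<integral>t. iexp (- (y * t)) * of_real (g t) \<partial>lborel)" for y
    unfolding G_def by (subst Bochner_Integration.integral_cnj[symmetric]) (simp add: exp_cnj)
  define L where "L = (\<integral>t. \<bar>g t\<bar> \<partial>lborel)"
  have GL: "cmod (G y) \<le> L" for y
    unfolding G_def L_def
    by (rule order_trans[OF integral_norm_bound]) (simp add: norm_mult)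
  have L0: "0 \<le> L" using GL[of 0] norm_ge_zero order_trans by blast
  \<comment> \<open>Writing out \<open>cnj (G y)\<close> and integrating over \<open>y\<close> first
    leaves the Fourier transform of the weight at \<open>s - t\<close>, which is
    \<open>k (s - t)\<close>.\<close>
  have inner: "(\<integral>y. of_real (w y) * cnj (G y) * iexp (y * s) \<partial>lborel)
      = (\<integral>t. of_real (g t * k (s - t)) \<partial>lborel)" for s
  proof -
    have "(\<integral>y. of_real (w y) * cnj (G y) * iexp (y * s) \<partial>lborel)
      = (\<integral>y. (\<integral>t. of_real (w y * g t) * iexp ((s - t) * y) \<partial>lborel) \<partial>lborel)"
    proof (rule Bochner_Integration.integral_cong[OF refl])
      fix y :: real
      have "(\<integral>t. of_real (w y * g t) * iexp ((s - t) * y) \<partial>lborel)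
        = (\<integral>t. (of_real (w y) * iexp (y * s)) * (iexp (- (y * t)) * of_real (g t)) \<partial>lborel)"
        by (intro Bochner_Integration.integral_cong[OF refl])
          (simp add: algebra_simps flip: exp_add)
      also have "\<dots> = of_real (w y) * cnj (G y) * iexp (y * s)"
        unfolding cnjG by (subst integral_mult_right_zero) (simp add: mult_ac)
      finally show "of_real (w y) * cnj (G y) * iexp (y * s)
        = (\<integral>t. of_real (w y * g t) * iexp ((s - t) * y) \<partial>lborel)" ..
    qed
    also have "\<dots> = (\<integral>t. (\<integral>y. of_real (w y * g t) * iexp ((s - t) * y) \<partial>lborel) \<partial>lborel)"
      by (rule lborel_pair.Fubini_integral[symmetric])
        (rule integrable_pair_bounded_mult[OF w(1) g, where C = 1], auto)
    also have "\<dots> = (\<integral>t. of_real (g t) * (\<integral>y. of_real (w y) * iexp ((s - t) * y) \<partial>lborel) \<partial>lborel)"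
      by (subst integral_mult_right_zero[symmetric]) (simp add: mult_ac)
    also have "\<dots> = (\<integral>t. of_real (g t * k (s - t)) \<partial>lborel)"
      unfolding w_def fourier_gaussian[OF n] k_def by simp
    finally show ?thesis .
  qed
  have bnd: "w y * (cmod (G y))\<^sup>2 \<le> L\<^sup>2 * w y" for y
    using mult_right_mono[OF power_mono[OF GL[of y] norm_ge_zero, of 2] w(2)[of y]]
    by (simp add: mult_ac)
  have int: "integrable lborel (\<lambda>y. w y * (cmod (G y))\<^sup>2)"
    by (rule Bochner_Integration.integrable_bound[OF integrable_mult_right[OF w(1), of "L\<^sup>2"]])
      (use bnd w(2) in \<open>auto simp: abs_mult\<close>)
  have "complex_of_real (\<integral>y. w y * (cmod (G y))\<^sup>2 \<partial>lborel)
      = (\<integral>y. of_real (w y) * cnj (G y) * G y \<partial>lborel)"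
    by (subst integral_complex_of_real[symmetric])
      (simp only: of_real_mult complex_norm_square mult_ac)
  also have "\<dots> = (\<integral>y. (\<integral>s. of_real (w y * g s) * (cnj (G y) * iexp (y * s)) \<partial>lborel) \<partial>lborel)"
  proof (rule Bochner_Integration.integral_cong[OF refl])
    fix y :: real
    have "of_real (w y) * cnj (G y) * G y
        = (\<integral>s. (of_real (w y) * cnj (G y)) * (iexp (y * s) * of_real (g s)) \<partial>lborel)"
      unfolding integral_mult_right_zero G_def[symmetric] ..
    also have "\<dots> = (\<integral>s. of_real (w y * g s) * (cnj (G y) * iexp (y * s)) \<partial>lborel)"
      by (simp only: of_real_mult mult_ac)
    finally show "of_real (w y) * cnj (G y) * G y
        = (\<integral>s. of_real (w y * g s) * (cnj (G y) * iexp (y * s)) \<partial>lborel)" .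
  qed
  \<comment> \<open>The bounded factor is now \<open>cnj (G y)\<close> times a phase, hence the
    constant \<open>L\<close>.\<close>
  also have "\<dots> = (\<integral>s. (\<integral>y. of_real (w y * g s) * (cnj (G y) * iexp (y * s)) \<partial>lborel) \<partial>lborel)"
    by (rule lborel_pair.Fubini_integral[symmetric])
      (rule integrable_pair_bounded_mult[OF w(1) g, where C = L], auto simp: norm_mult GL)
  also have "\<dots> = (\<integral>s. of_real (g s) * (\<integral>t. of_real (g t * k (s - t)) \<partial>lborel) \<partial>lborel)"
    unfolding inner[symmetric] by (subst integral_mult_right_zero[symmetric]) (simp add: mult_ac)
  also have "\<dots> = (\<integral>s. (\<integral>t. of_real (g s * g t * k (s - t)) \<partial>lborel) \<partial>lborel)"
    by (subst integral_mult_right_zero[symmetric]) (simp add: mult_ac)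
  finally have eq: "complex_of_real (\<integral>y. w y * (cmod (G y))\<^sup>2 \<partial>lborel)
      = (\<integral>s. (\<integral>t. of_real (g s * g t * k (s - t)) \<partial>lborel) \<partial>lborel)" .
  have kint: "(\<integral>\<^sup>+t. ennreal (k (s - t)) \<partial>lborel) = ennreal (2 * pi)" 
             "(\<integral>\<^sup>+t. ennreal (k (t - s)) \<partial>lborel) = ennreal (2 * pi)" for s
  proof -
    \<comment> \<open>\<open>k\<close> is a Gaussian of width \<open>1 / n\<close>: its height
      \<open>sqrt (2 * pi) * n\<close> times \<open>sqrt (2 * pi) / n\<close> gives a mass free of
      \<open>n\<close>.\<close>
    have n': "0 < 1 / n" using n by simp
    have ke: "k u = sqrt (2 * pi) * n * exp (- (u / (1 / n))\<^sup>2 / 2)" for u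
      by (simp add: k_def mult.commute)
    have ki: "(\<integral>\<^sup>+u. ennreal (k u) \<partial>lborel) = ennreal (2 * pi)"
    proof -
      have "(\<integral>\<^sup>+u. ennreal (k u) \<partial>lborel) = ennreal (\<integral>u. k u \<partial>lborel)"
        unfolding ke using n by (intro nn_integral_eq_integral integrable_mult_right integrable_gaussian[OF n']) auto
      also have "(\<integral>u. k u \<partial>lborel) = 2 * pi"
        unfolding ke integral_mult_right_zero integral_gaussian[OF n'] using n by simp
      finally show ?thesis .
    qed
    show "(\<integral>\<^sup>+t. ennreal (k (s - t)) \<partial>lborel) = ennreal (2 * pi)"
      using nn_integral_real_affine[of "\<lambda>u. ennreal (k u)" "-1" s] ki by simp
    show "(\<integral>\<^sup>+t. ennreal (k (t - s)) \<partial>lborel) = ennreal (2 * pi)"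
      using nn_integral_real_affine[of "\<lambda>u. ennreal (k u)" 1 "-s"] ki by simp
  qed
  let ?N = "\<integral>\<^sup>+t. ennreal ((g t)\<^sup>2) \<partial>lborel"
  have "(\<integral>\<^sup>+y. ennreal (w y * (cmod (G y))\<^sup>2) \<partial>lborel)
      = ennreal (\<integral>y. w y * (cmod (G y))\<^sup>2 \<partial>lborel)"
    by (rule nn_integral_eq_integral[OF int]) (auto simp: w)
  also have "\<dots> = ennreal (cmod (\<integral>s. (\<integral>t. of_real (g s * g t * k (s - t)) \<partial>lborel) \<partial>lborel))"
    unfolding eq[symmetric] norm_of_real
    by (subst abs_of_nonneg) (auto intro!: integral_nonneg_AE simp: w)
  also have "\<dots> \<le> (\<integral>\<^sup>+s. ennreal (cmod (\<integral>t. of_real (g s * g t * k (s - t)) \<partial>lborel)) \<partial>lborel)"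
    by (rule ennreal_norm_integral_le)
  also have "\<dots> \<le> (\<integral>\<^sup>+s. (\<integral>\<^sup>+t. ennreal (cmod (of_real (g s * g t * k (s - t)))) \<partial>lborel) \<partial>lborel)"
    by (intro nn_integral_mono ennreal_norm_integral_le)
  \<comment> \<open>The half-squares decouple \<open>s\<close> from \<open>t\<close>. In each
    summand \<open>k\<close> can then be integrated over the variable in which \<open>g\<close> does
    not occur, after an exchange of order in the second one.\<close>
  also have "\<dots> \<le> (\<integral>\<^sup>+s. (\<integral>\<^sup>+t. ennreal ((g s)\<^sup>2 / 2) * ennreal (k (s - t))
      + ennreal ((g t)\<^sup>2 / 2) * ennreal (k (s - t)) \<partial>lborel) \<partial>lborel)"
  proof (intro nn_integral_mono)
    fix s t
    have "\<bar>g s * g t\<bar> \<le> (g s)\<^sup>2 / 2 + (g t)\<^sup>2 / 2"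
      using sum_squares_bound[of "\<bar>g s\<bar>" "\<bar>g t\<bar>"] by (simp add: abs_mult)
    from mult_right_mono[OF this k0[of "s - t"]]
    have "cmod (of_real (g s * g t * k (s - t))) \<le> (g s)\<^sup>2 / 2 * k (s - t) + (g t)\<^sup>2 / 2 * k (s - t)"
      unfolding norm_of_real abs_mult[of "g s * g t"] using k0[of "s - t"] by (simp add: distrib_right)
    then show "ennreal (cmod (of_real (g s * g t * k (s - t)))) \<le> ennreal ((g s)\<^sup>2 / 2) * ennreal (k (s - t))
      + ennreal ((g t)\<^sup>2 / 2) * ennreal (k (s - t))"
      using k0[of "s - t"] by (simp flip: ennreal_mult ennreal_plus)
  qed
  also have "\<dots> = (\<integral>\<^sup>+s. (\<integral>\<^sup>+t. ennreal ((g s)\<^sup>2 / 2) * ennreal (k (s - t)) \<partial>lborel) \<partial>lborel)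
      + (\<integral>\<^sup>+s. (\<integral>\<^sup>+t. ennreal ((g t)\<^sup>2 / 2) * ennreal (k (s - t)) \<partial>lborel) \<partial>lborel)"
    by (subst nn_integral_add[symmetric]) (auto simp: nn_integral_add)
  also have "(\<integral>\<^sup>+s. (\<integral>\<^sup>+t. ennreal ((g t)\<^sup>2 / 2) * ennreal (k (s - t)) \<partial>lborel) \<partial>lborel)
      = (\<integral>\<^sup>+t. (\<integral>\<^sup>+s. ennreal ((g t)\<^sup>2 / 2) * ennreal (k (s - t)) \<partial>lborel) \<partial>lborel)"
    by (rule lborel_pair.Fubini') measurable
  also have "(\<integral>\<^sup>+s. (\<integral>\<^sup>+t. ennreal ((g s)\<^sup>2 / 2) * ennreal (k (s - t)) \<partial>lborel) \<partial>lborel)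
      = (\<integral>\<^sup>+s. ennreal ((g s)\<^sup>2 / 2) * ennreal (2 * pi) \<partial>lborel)"
    by (simp add: nn_integral_cmult kint)
  also have "(\<integral>\<^sup>+t. (\<integral>\<^sup>+s. ennreal ((g t)\<^sup>2 / 2) * ennreal (k (s - t)) \<partial>lborel) \<partial>lborel)
      = (\<integral>\<^sup>+s. ennreal ((g s)\<^sup>2 / 2) * ennreal (2 * pi) \<partial>lborel)"
    by (simp add: nn_integral_cmult kint)
  also have "\<dots> + \<dots> = (\<integral>\<^sup>+s. ennreal (2 * pi) * ennreal ((g s)\<^sup>2) \<partial>lborel)"
    by (subst nn_integral_add[symmetric]) (auto simp flip: ennreal_mult ennreal_plus simp: mult_ac)
  also have "\<dots> = ennreal (2 * pi) * ?N"
    by (rule nn_integral_cmult) simp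
  finally show ?thesis unfolding w_def G_def .
qed

text \<open>The weighted bound does not depend on the width of the Gaussian. As the width grows the
  weight tends to 1, and Fatou's lemma carries the bound to the limit.\<close>

lemma fourier_bessel:
  fixes g :: "real \<Rightarrow> real"
  assumes g: "integrable lborel g"
  shows "(\<integral>\<^sup>+y. ennreal ((cmod (\<integral>t. iexp (y * t) * of_real (g t) \<partial>lborel))\<^sup>2) \<partial>lborel)
    \<le> ennreal (2 * pi) * (\<integral>\<^sup>+t. ennreal ((g t)\<^sup>2) \<partial>lborel)"
proof -
  define G where "G y = (\<integral>t. iexp (y * t) * of_real (g t) \<partial>lborel)" for y
  have [measurable]: "g \<in> borel_measurable borel" using g by auto
  have [measurable]: "G \<in> borel_measurable borel"
    unfolding G_def by measurable
  \<comment> \<open>The widths are \<open>Suc n\<close> because the weighted bound asks for a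
    positive one.\<close>
  have lim: "(\<lambda>n. ennreal (exp (- (y / real (Suc n))\<^sup>2 / 2) * (cmod (G y))\<^sup>2)) \<longlonglongrightarrow> ennreal ((cmod (G y))\<^sup>2)" for y
  proof -
    have "(\<lambda>n. y / real (Suc n)) \<longlonglongrightarrow> 0"
      using LIMSEQ_Suc[OF lim_const_over_n[of y]] .
    then have "(\<lambda>n. exp (- (y / real (Suc n))\<^sup>2 / 2) * (cmod (G y))\<^sup>2) \<longlonglongrightarrow> exp (- 0\<^sup>2 / 2) * (cmod (G y))\<^sup>2"
      by (intro tendsto_intros) simp_all
    then show ?thesis by (intro tendsto_ennrealI) simp
  qed
  have "(\<integral>\<^sup>+y. ennreal ((cmod (G y))\<^sup>2) \<partial>lborel)
      = (\<integral>\<^sup>+y. liminf (\<lambda>n. ennreal (exp (- (y / real (Suc n))\<^sup>2 / 2) * (cmod (G y))\<^sup>2)) \<partial>lborel)"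
    using lim by (intro nn_integral_cong) (metis lim_imp_Liminf sequentially_bot)
  also have "\<dots> \<le> liminf (\<lambda>n. (\<integral>\<^sup>+y. ennreal (exp (- (y / real (Suc n))\<^sup>2 / 2) * (cmod (G y))\<^sup>2) \<partial>lborel))"
    by (rule nn_integral_liminf) measurable
  also have "\<dots> \<le> liminf (\<lambda>n. ennreal (2 * pi) * (\<integral>\<^sup>+t. ennreal ((g t)\<^sup>2) \<partial>lborel))"
    unfolding G_def
    by (intro Liminf_mono always_eventually allI gaussian_weighted_bessel[OF g]) simp
  finally show ?thesis by (simp add: G_def Liminf_const)
qed

text \<open>The positive and negative parts of \<open>g\<close> have equal Fourier transforms.
  Normalised, they are probability densities with the same characteristic function, so they agree
  almost everywhere.\<close>

lemma fourier_eq_zero_imp_AE_zero: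
  fixes g :: "real \<Rightarrow> real"
  assumes g: "integrable lborel g"
    and zero: "\<And>y. (\<integral>t. iexp (y * t) * of_real (g t) \<partial>lborel) = 0"
  shows "AE t in lborel. g t = 0"
proof -
  define p where "p t = max 0 (g t)" for t
  define m where "m t = max 0 (- g t)" for t
  have [measurable]: "g \<in> borel_measurable borel" using g by auto
  have [measurable]: "p \<in> borel_measurable borel" "m \<in> borel_measurable borel"
    unfolding p_def m_def by measurable
  have ip: "integrable lborel p" and im: "integrable lborel m"
    unfolding p_def m_def using g by (auto intro: integrable_max)
  have pm: "g t = p t - m t" for t by (simp add: p_def m_def max_def)
  have ie: "integrable lborel (\<lambda>t. iexp (y * t) * complex_of_real (h t))"
    if "integrable lborel h" for y h
  proof -
    have [measurable]: "h \<in> borel_measurable borel" using that by auto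
    show ?thesis
      by (rule Bochner_Integration.integrable_bound[OF that]) (auto simp: norm_mult)
  qed
  have eq: "(\<integral>t. iexp (y * t) * of_real (p t) \<partial>lborel) = (\<integral>t. iexp (y * t) * of_real (m t) \<partial>lborel)" for y
  proof -
    have "0 = (\<integral>t. iexp (y * t) * of_real (p t) - iexp (y * t) * of_real (m t) \<partial>lborel)"
      using zero[of y] unfolding pm by (simp add: right_diff_distrib)
    also have "\<dots> = (\<integral>t. iexp (y * t) * of_real (p t) \<partial>lborel) - (\<integral>t. iexp (y * t) * of_real (m t) \<partial>lborel)"
      by (rule Bochner_Integration.integral_diff[OF ie[OF ip] ie[OF im]])
    finally show ?thesis by simp
  qed
  define c where "c = (\<integral>t. p t \<partial>lborel)"
  \<comment> \<open>At frequency 0 the transforms are the total masses, so one constant normalises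
    both parts.\<close>
  have "complex_of_real c = of_real (\<integral>t. m t \<partial>lborel)"
    using eq[of 0] by (simp add: c_def)
  then have cm: "c = (\<integral>t. m t \<partial>lborel)" by (simp only: of_real_eq_iff)
  have c0: "0 \<le> c" unfolding c_def by (rule integral_nonneg_AE) (auto simp: p_def)
  have p0: "0 \<le> p t" and m0: "0 \<le> m t" for t by (simp_all add: p_def m_def)
  show ?thesis
  proof (cases "c = 0")
    \<comment> \<open>Nothing can be normalised here, but nonnegative functions of integral 0 vanish
      almost everywhere.\<close>
    case True
    have "AE t in lborel. p t = 0"
      using True integral_nonneg_eq_0_iff_AE[OF ip] p0 by (simp add: c_def)
    moreover have "AE t in lborel. m t = 0"
      using True integral_nonneg_eq_0_iff_AE[OF im] m0 by (simp add: cm)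
    ultimately show ?thesis by eventually_elim (simp add: pm)
  next
    case False
    then have c: "0 < c" using c0 by simp
    have dist: "real_distribution (density lborel (\<lambda>t. ennreal (h t / c)))"
      if "integrable lborel h" "\<And>t. 0 \<le> h t" "(\<integral>t. h t \<partial>lborel) = c" for h
    proof -
      have [measurable]: "h \<in> borel_measurable borel" using that by auto
      have "(\<integral>\<^sup>+t. ennreal (h t / c) \<partial>lborel) = ennreal (\<integral>t. h t / c \<partial>lborel)"
        using that c by (intro nn_integral_eq_integral) auto
      also have "\<dots> = 1" using that c by simp
      finally have "emeasure (density lborel (\<lambda>t. ennreal (h t / c))) (space (density lborel (\<lambda>t. ennreal (h t / c)))) = 1"
        by (simp add: emeasure_density)
      then show ?thesis
        by (auto simp: real_distribution_def real_distribution_axioms_def intro: prob_spaceI)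
    qed
    have ch: "char (density lborel (\<lambda>t. ennreal (h t / c))) y
        = (\<integral>t. iexp (y * t) * of_real (h t) \<partial>lborel) / c"
      if "h \<in> borel_measurable borel" "\<And>t. 0 \<le> h t" for h y
    proof -
      note [measurable] = that(1)
      have "char (density lborel (\<lambda>t. ennreal (h t / c))) y
          = (\<integral>t. (h t / c) *\<^sub>R iexp (y * t) \<partial>lborel)"
        unfolding char_def using that c by (subst integral_density) auto
      also have "\<dots> = (\<integral>t. iexp (y * t) * of_real (h t) / c \<partial>lborel)"
        by (simp add: scaleR_conv_of_real mult_ac)
      finally show ?thesis by simp
    qed
    have "density lborel (\<lambda>t. ennreal (p t / c)) = density lborel (\<lambda>t. ennreal (m t / c))"
    proof (rule Levy_uniqueness)
      show "char (density lborel (\<lambda>t. ennreal (p t / c))) = char (density lborel (\<lambda>t. ennreal (m t / c)))"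
        by (rule ext) (simp only: ch p0 m0 eq \<open>p \<in> _\<close> \<open>m \<in> _\<close>)
    qed (auto intro!: dist ip im p0 m0 simp: c_def[symmetric] cm[symmetric])
    then have "AE t in lborel. ennreal (p t / c) = ennreal (m t / c)"
      by (rule sigma_finite_measure.density_unique[OF sigma_finite_lborel, rotated 2]) auto
    then show ?thesis
    proof eventually_elim
      case (elim t)
      then have "p t / c = m t / c" using c by (subst (asm) ennreal_inj) (auto simp: p0 m0)
      then show ?case using c by (simp add: pm)
    qed
  qed
qed

section \<open>The complex Bargmann transform\<close>

definition exp_integrable :: "(real \<Rightarrow> real) \<Rightarrow> bool" where
  "exp_integrable w \<longleftrightarrow> (\<forall>a. integrable lborel (\<lambda>t. exp (a * \<bar>t\<bar>) * w t))"

text \<open>Differentiating a Laplace transform puts a factor \<open>t\<close> into the integrand.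
  Since \<open>\<bar>t\<bar> \<le> exp \<bar>t\<bar>\<close>, this costs one unit in the exponent;
  as every exponent is allowed, the class is closed under it.\<close>

lemma exp_integrable_times_id:
  assumes w: "exp_integrable w"
  shows "exp_integrable (\<lambda>t. t * w t)"
  unfolding exp_integrable_def
proof
  fix a
  have "integrable lborel (\<lambda>t. exp (0 * \<bar>t\<bar>) * w t)"
    using w unfolding exp_integrable_def by blast
  then have [measurable]: "w \<in> borel_measurable borel" by simp
  show "integrable lborel (\<lambda>t. exp (a * \<bar>t\<bar>) * (t * w t))"
  proof (rule Bochner_Integration.integrable_bound)
    show "integrable lborel (\<lambda>t. exp ((a + 1) * \<bar>t\<bar>) * w t)"
      using w unfolding exp_integrable_def by blast
    have "norm (exp (a * \<bar>t\<bar>) * (t * w t)) \<le> norm (exp ((a + 1) * \<bar>t\<bar>) * w t)" for t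
    proof -
      have "\<bar>t\<bar> \<le> exp \<bar>t\<bar>"
        using exp_ge_add_one_self[of "\<bar>t\<bar>"] by linarith
      then have "\<bar>t\<bar> * (exp (a * \<bar>t\<bar>) * \<bar>w t\<bar>) \<le> exp \<bar>t\<bar> * (exp (a * \<bar>t\<bar>) * \<bar>w t\<bar>)"
        by (intro mult_right_mono) auto
      then show ?thesis
        by (simp add: abs_mult ring_distribs exp_add mult_ac)
    qed
    then show "AE t in lborel. norm (exp (a * \<bar>t\<bar>) * (t * w t)) \<le> norm (exp ((a + 1) * \<bar>t\<bar>) * w t)"
      by simp
  qed measurable
qed

definition laplace :: "(real \<Rightarrow> real) \<Rightarrow> complex \<Rightarrow> complex" where
  "laplace w z = (\<integral>t. exp (of_real t * z) * of_real (w t) \<partial>lborel)"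

lemma integrable_laplace:
  assumes w: "exp_integrable w"
  shows "integrable lborel (\<lambda>t. exp (of_real t * z) * complex_of_real (w t))"
proof -
  have "integrable lborel (\<lambda>t. exp (0 * \<bar>t\<bar>) * w t)"
    using w unfolding exp_integrable_def by blast
  then have [measurable]: "w \<in> borel_measurable borel" by simp
  show ?thesis
  proof (rule Bochner_Integration.integrable_bound)
    show "integrable lborel (\<lambda>t. exp (cmod z * \<bar>t\<bar>) * w t)"
      using w unfolding exp_integrable_def by blast
    have "norm (exp (of_real t * z) * complex_of_real (w t)) \<le> norm (exp (cmod z * \<bar>t\<bar>) * w t)" for t
    proof -
      have "cmod (exp (of_real t * z)) \<le> exp (cmod z * \<bar>t\<bar>)"
        using norm_exp[of "of_real t * z"] by (simp add: norm_mult mult.commute)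
      then show ?thesis by (simp add: norm_mult abs_mult mult_right_mono)
    qed
    then show "AE t in lborel. norm (exp (of_real t * z) * complex_of_real (w t)) \<le> norm (exp (cmod z * \<bar>t\<bar>) * w t)"
      by simp
  qed measurable
qed

text \<open>The second order Taylor remainder, with the powers of \<open>t\<close> absorbed into an
  exponential: this gives a majorant that \<open>exp_integrable\<close> controls, with
  \<open>h\<close> entering only through the square of its norm.\<close>

lemma norm_exp_minus_linear_le:
  assumes "norm h \<le> 1"
  shows "norm (exp (of_real t * h) - 1 - of_real t * h :: complex) \<le> (norm h)\<^sup>2 * (2 * exp (2 * \<bar>t\<bar>))"
proof -
  have t: "\<bar>t\<bar>\<^sup>2 \<le> 2 * exp \<bar>t\<bar>"
    using exp_lower_Taylor_quadratic[of "\<bar>t\<bar>"] by simp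
  have "norm (exp (of_real t * h) - 1 - of_real t * h :: complex) \<le> exp (\<bar>t\<bar> * norm h) * (\<bar>t\<bar> * norm h)\<^sup>2"
    using Taylor_exp_field[of "of_real t * h" 1] by (simp add: norm_mult power2_eq_square diff_diff_eq)
  also have "\<dots> \<le> exp \<bar>t\<bar> * ((norm h)\<^sup>2 * (2 * exp \<bar>t\<bar>))"
    using mult_left_mono[OF assms, of "\<bar>t\<bar>"] mult_left_mono[OF t, of "(norm h)\<^sup>2"]
    by (intro mult_mono) (auto simp: power_mult_distrib mult.commute)
  also have "\<dots> = (norm h)\<^sup>2 * (2 * exp (2 * \<bar>t\<bar>))"
    unfolding exp_double by (simp add: power2_eq_square mult_ac)
  finally show ?thesis .
qed

text \<open>Differentiation under the integral: integrating the Taylor remainder of the kernel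
  bounds the error of the difference quotient by \<open>cmod h * K\<close>, with \<open>K\<close>
  independent of \<open>h\<close>.\<close>

lemma has_field_derivative_laplace:
  assumes w: "exp_integrable w"
  shows "(laplace w has_field_derivative laplace (\<lambda>t. t * w t) z) (at z)"
proof -
  \<comment> \<open>The exponent \<open>cmod z + 2\<close> collects the growth of
    \<open>exp (of_real t * z)\<close> and the factor \<open>exp (2 * \<bar>t\<bar>)\<close> of the
    remainder bound.\<close>
  define K where "K = (\<integral>t. 2 * (exp ((cmod z + 2) * \<bar>t\<bar>) * \<bar>w t\<bar>) \<partial>lborel)"
  have "integrable lborel (\<lambda>t. exp ((cmod z + 2) * \<bar>t\<bar>) * w t)"
    using w unfolding exp_integrable_def by blast
  from integrable_abs[OF this]
  have Ki: "integrable lborel (\<lambda>t. 2 * (exp ((cmod z + 2) * \<bar>t\<bar>) * \<bar>w t\<bar>))"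
    by (simp add: abs_mult)
  note int = integrable_laplace[OF w] integrable_laplace[OF exp_integrable_times_id[OF w]]
  have bound: "cmod (laplace w (z + h) - laplace w z - h * laplace (\<lambda>t. t * w t) z) \<le> (cmod h)\<^sup>2 * K"
    if h: "cmod h \<le> 1" for h
  proof -
    have "laplace w (z + h) - laplace w z - h * laplace (\<lambda>t. t * w t) z
      = (\<integral>t. exp (of_real t * (z + h)) * of_real (w t) - exp (of_real t * z) * of_real (w t)
          - h * (exp (of_real t * z) * of_real (t * w t)) \<partial>lborel)"
      unfolding laplace_def
      by (subst Bochner_Integration.integral_diff, (intro Bochner_Integration.integrable_diff integrable_mult_right int)+,
          subst Bochner_Integration.integral_diff, (intro int)+, subst integral_mult_right_zero, rule refl)
    also have "\<dots> = (\<integral>t. (exp (of_real t * h) - 1 - of_real t * h) * exp (of_real t * z) * of_real (w t) \<partial>lborel)"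
      by (rule Bochner_Integration.integral_cong[OF refl])
        (simp add: algebra_simps exp_add)
    also have "cmod \<dots> \<le> (\<integral>t. (cmod h)\<^sup>2 * (2 * (exp ((cmod z + 2) * \<bar>t\<bar>) * \<bar>w t\<bar>)) \<partial>lborel)"
    proof (rule Bochner_Integration.integral_norm_bound_integral)
      show "integrable lborel (\<lambda>t. (exp (of_real t * h) - 1 - of_real t * h) * exp (of_real t * z) * complex_of_real (w t))"
      proof -
        have "integrable lborel (\<lambda>t. exp (of_real t * (z + h)) * of_real (w t) - exp (of_real t * z) * of_real (w t)
          - h * (exp (of_real t * z) * complex_of_real (t * w t)))"
          by (intro Bochner_Integration.integrable_diff integrable_mult_right int)
        then show ?thesis by (simp add: algebra_simps exp_add)
      qed
      show "integrable lborel (\<lambda>t. (cmod h)\<^sup>2 * (2 * (exp ((cmod z + 2) * \<bar>t\<bar>) * \<bar>w t\<bar>)))"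
        by (rule integrable_mult_right[OF Ki])
      fix t
      have "cmod (exp (of_real t * z)) \<le> exp (cmod z * \<bar>t\<bar>)"
        using norm_exp[of "of_real t * z"] by (simp add: norm_mult mult.commute)
      then have "cmod (exp (of_real t * h) - 1 - of_real t * h) * cmod (exp (of_real t * z)) * \<bar>w t\<bar>
        \<le> (cmod h)\<^sup>2 * (2 * exp (2 * \<bar>t\<bar>)) * exp (cmod z * \<bar>t\<bar>) * \<bar>w t\<bar>"
        by (intro mult_right_mono mult_mono norm_exp_minus_linear_le[OF h]) auto
      also have "\<dots> = (cmod h)\<^sup>2 * (2 * (exp ((cmod z + 2) * \<bar>t\<bar>) * \<bar>w t\<bar>))"
        by (simp add: distrib_right exp_add)
      finally show "cmod ((exp (of_real t * h) - 1 - of_real t * h) * exp (of_real t * z) * complex_of_real (w t))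
        \<le> (cmod h)\<^sup>2 * (2 * (exp ((cmod z + 2) * \<bar>t\<bar>) * \<bar>w t\<bar>))"
        by (simp add: norm_mult)
    qed
    also have "\<dots> = (cmod h)\<^sup>2 * K"
      unfolding K_def by (rule integral_mult_right_zero)
    finally show ?thesis .
  qed
  have "((\<lambda>h. (laplace w (z + h) - laplace w z) / h - laplace (\<lambda>t. t * w t) z) \<longlongrightarrow> 0) (at 0)"
  proof (rule Lim_null_comparison)
    show "((\<lambda>h. cmod h * K) \<longlongrightarrow> 0) (at 0)"
      by (intro tendsto_mult_left_zero tendsto_norm_zero) simp
    have "\<forall>\<^sub>F h in at (0::complex). dist h 0 < 1 \<and> h \<noteq> 0"
      unfolding eventually_at by (rule exI[of _ 1]) auto
    then show "\<forall>\<^sub>F h in at 0. cmod ((laplace w (z + h) - laplace w z) / h - laplace (\<lambda>t. t * w t) z) \<le> cmod h * K"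
    proof eventually_elim
      case (elim h)
      then have h: "cmod h \<le> 1" "h \<noteq> 0" by auto
      have "(laplace w (z + h) - laplace w z) / h - laplace (\<lambda>t. t * w t) z
        = (laplace w (z + h) - laplace w z - h * laplace (\<lambda>t. t * w t) z) / h"
        using h by (simp add: field_simps)
      then have "cmod ((laplace w (z + h) - laplace w z) / h - laplace (\<lambda>t. t * w t) z) \<le> ((cmod h)\<^sup>2 * K) / cmod h"
        using bound[OF h(1)] by (simp add: norm_divide divide_right_mono)
      also have "\<dots> = cmod h * K" using h by (simp add: power2_eq_square)
      finally show ?case .
    qed
  qed
  then show ?thesis
    unfolding DERIV_def by (rule LIM_zero_cancel)
qed

section \<open>The Bargmann transform and its derivative\<close>

definition bargmann_kernel :: "complex \<Rightarrow> real \<Rightarrow> complex" where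
  "bargmann_kernel z t =
     of_real (pi powr (-3/4)) * exp ((-1/2) *\<^sub>R (z\<^sup>2 + of_real (t\<^sup>2)) + (sqrt 2 * t) *\<^sub>R z)"

definition bargmann :: "(real \<Rightarrow> real) \<Rightarrow> complex \<Rightarrow> complex" where
  "bargmann g z = (\<integral>t. bargmann_kernel z t * of_real (g t) \<partial>lborel)"

text \<open>In \<open>t\<close> the kernel is a Laplace kernel times this Gaussian, so the condition
  is the one under which the transform is a Laplace transform of an admissible function.\<close>

definition gauss_exp_integrable :: "(real \<Rightarrow> real) \<Rightarrow> bool" where
  "gauss_exp_integrable g \<longleftrightarrow> exp_integrable (\<lambda>t. exp (- t\<^sup>2 / 2) * g t)"

lemma gauss_exp_integrable_times_id:
  "gauss_exp_integrable g \<Longrightarrow> gauss_exp_integrable (\<lambda>t. t * g t)"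
  unfolding gauss_exp_integrable_def by (drule exp_integrable_times_id) (simp add: mult_ac)

text \<open>A Gaussian times any exponential is still square integrable, and a product of two square
  integrable functions is dominated by the sum of their squares.\<close>

lemma gauss_exp_integrableI:
  assumes [measurable]: "g \<in> borel_measurable borel"
    and g: "integrable lborel (\<lambda>t. (g t)\<^sup>2 :: real)"
  shows "gauss_exp_integrable g"
  unfolding gauss_exp_integrable_def exp_integrable_def
proof
  fix a :: real
  show "integrable lborel (\<lambda>t. exp (a * \<bar>t\<bar>) * (exp (- t\<^sup>2 / 2) * g t))"
  proof (rule Bochner_Integration.integrable_bound)
    show "integrable lborel (\<lambda>t. exp (2 * a\<^sup>2) * exp (- (t / 1)\<^sup>2 / 2) + (g t)\<^sup>2)"
      by (intro Bochner_Integration.integrable_add integrable_mult_right integrable_gaussian g) simp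
    have "norm (exp (a * \<bar>t\<bar>) * (exp (- t\<^sup>2 / 2) * g t)) \<le> norm (exp (2 * a\<^sup>2) * exp (- (t / 1)\<^sup>2 / 2) + (g t)\<^sup>2)" for t
    proof -
      define e where "e = exp (a * \<bar>t\<bar>) * exp (- t\<^sup>2 / 2)"
      have e0: "0 \<le> e" by (simp add: e_def)
      \<comment> \<open>Nonnegativity of \<open>(\<bar>t\<bar> - 2 * a)\<^sup>2\<close> lets half of
        the quadratic decay absorb the linear term; the other half remains as an integrable
        Gaussian.\<close>
      have "2 * a * \<bar>t\<bar> - t\<^sup>2 \<le> 2 * a\<^sup>2 - t\<^sup>2 / 2"
        using zero_le_power2[of "\<bar>t\<bar> - 2 * a"] by (simp add: power2_eq_square algebra_simps)
      then have "e\<^sup>2 \<le> exp (2 * a\<^sup>2) * exp (- (t / 1)\<^sup>2 / 2)"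
        unfolding e_def by (simp flip: exp_add exp_double add: mult.commute algebra_simps)
      moreover have "e * \<bar>g t\<bar> \<le> e\<^sup>2 + (g t)\<^sup>2"
        using sum_squares_bound[of e "\<bar>g t\<bar>"] mult_nonneg_nonneg[OF e0 abs_ge_zero[of "g t"]] by simp
      ultimately have "e * \<bar>g t\<bar> \<le> exp (2 * a\<^sup>2) * exp (- (t / 1)\<^sup>2 / 2) + (g t)\<^sup>2" by linarith
      then show ?thesis
        by (simp add: e_def abs_mult mult.assoc)
    qed
    then show "AE t in lborel. norm (exp (a * \<bar>t\<bar>) * (exp (- t\<^sup>2 / 2) * g t))
        \<le> norm (exp (2 * a\<^sup>2) * exp (- (t / 1)\<^sup>2 / 2) + (g t)\<^sup>2)" by simp
  qed measurable
qed

lemma bargmann_kernel_laplace: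
  "bargmann_kernel z t * of_real r
    = of_real (pi powr (-3/4)) * exp (- z\<^sup>2 / 2) * (exp (of_real t * (of_real (sqrt 2) * z)) * of_real (exp (- t\<^sup>2 / 2) * r))"
proof -
  have "(-1/2) *\<^sub>R (z\<^sup>2 + of_real (t\<^sup>2)) + (sqrt 2 * t) *\<^sub>R z
      = - z\<^sup>2 / 2 + of_real t * (of_real (sqrt 2) * z) + of_real (- t\<^sup>2 / 2)"
    by (simp add: scaleR_conv_of_real field_simps)
  then have "bargmann_kernel z t = of_real (pi powr (-3/4)) *
      (exp (- z\<^sup>2 / 2) * exp (of_real t * (of_real (sqrt 2) * z)) * exp (of_real (- t\<^sup>2 / 2)))"
    unfolding bargmann_kernel_def by (simp only: exp_add)
  then show ?thesis
    by (simp only: exp_of_real of_real_mult mult_ac)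
qed

lemma bargmann_conv_laplace:
  "bargmann g z = of_real (pi powr (-3/4)) * exp (- z\<^sup>2 / 2) * laplace (\<lambda>t. exp (- t\<^sup>2 / 2) * g t) (of_real (sqrt 2) * z)"
  unfolding bargmann_def bargmann_kernel_laplace laplace_def by (rule integral_mult_right_zero)

lemma integrable_bargmann:
  assumes "gauss_exp_integrable g"
  shows "integrable lborel (\<lambda>t. bargmann_kernel z t * of_real (g t))"
  unfolding bargmann_kernel_laplace
  using assms by (intro integrable_mult_right integrable_laplace) (simp add: gauss_exp_integrable_def)

text \<open>The complex form of the intertwining relation: the Gaussian prefactor in
  \<open>z\<close> contributes the term with \<open>- z\<close>, and the chain rule on the Laplace
  factor contributes \<open>sqrt 2\<close> and multiplication by \<open>t\<close>.\<close>

lemma has_field_derivative_bargmann: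
  assumes g: "gauss_exp_integrable g"
  shows "(bargmann g has_field_derivative (of_real (sqrt 2) * bargmann (\<lambda>t. t * g t) z - z * bargmann g z)) (at z)"
proof -
  let ?w = "\<lambda>t. exp (- t\<^sup>2 / 2) * g t"
  let ?L = "\<lambda>z. laplace ?w (of_real (sqrt 2) * z)"
  let ?L' = "laplace (\<lambda>t. t * ?w t) (of_real (sqrt 2) * z) * of_real (sqrt 2)"
  have e: "((\<lambda>z::complex. exp (- z\<^sup>2 / 2)) has_field_derivative - z * exp (- z\<^sup>2 / 2)) (at z)"
    by (auto intro!: derivative_eq_intros)
  have L: "(?L has_field_derivative ?L') (at z)"
    by (rule DERIV_chain2[OF has_field_derivative_laplace[OF g[unfolded gauss_exp_integrable_def]] DERIV_cmult_Id])
  have eq: "bargmann g = (\<lambda>z. of_real (pi powr (-3/4)) * exp (- z\<^sup>2 / 2) * laplace ?w (of_real (sqrt 2) * z))"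
    by (rule ext) (rule bargmann_conv_laplace)
  have eq': "(\<lambda>t. exp (- t\<^sup>2 / 2) * (t * g t)) = (\<lambda>t. t * ?w t)"
    by (simp add: mult_ac)
  show ?thesis
    unfolding bargmann_conv_laplace[of "\<lambda>t. t * g t"] eq eq'
    by (rule DERIV_cong[OF DERIV_mult[OF DERIV_cmult[OF e] L]]) (simp add: algebra_simps)
qed

section \<open>Bargmann transforms: continuity, Fock norm and injectivity\<close>

lemma continuous_on_bargmann:
  assumes "gauss_exp_integrable g"
  shows "continuous_on A (bargmann g)"
  by (rule DERIV_continuous_on[OF has_field_derivative_at_within[OF has_field_derivative_bargmann[OF assms]]])

text \<open>Separates phase and growth. The square of
  \<open>exp ((x\<^sup>2 + y\<^sup>2) / 2)\<close> is exactly what the Fock weight cancels, so on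
  each vertical line the weighted norm is that of a Fourier transform.\<close>

lemma bargmann_conv_fourier:
  "bargmann g (Complex x y) = of_real (pi powr (-3/4)) * iexp (- (x * y)) * of_real (exp ((x\<^sup>2 + y\<^sup>2) / 2))
    * (\<integral>t. iexp (sqrt 2 * y * t) * of_real (exp (- (t - sqrt 2 * x)\<^sup>2 / 2) * g t) \<partial>lborel)"
proof -
  have "bargmann_kernel (Complex x y) t * of_real r = of_real (pi powr (-3/4)) * iexp (- (x * y)) * of_real (exp ((x\<^sup>2 + y\<^sup>2) / 2))
    * (iexp (sqrt 2 * y * t) * of_real (exp (- (t - sqrt 2 * x)\<^sup>2 / 2) * r))" for t r
  proof -
    have "(-1/2) *\<^sub>R ((Complex x y)\<^sup>2 + of_real (t\<^sup>2)) + (sqrt 2 * t) *\<^sub>R Complex x y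
      = \<i> * of_real (- (x * y)) + of_real ((x\<^sup>2 + y\<^sup>2) / 2) + \<i> * of_real (sqrt 2 * y * t)
        + of_real (- (t - sqrt 2 * x)\<^sup>2 / 2)"
      by (simp add: complex_eq_iff power2_eq_square) (simp add: field_simps)
    then have "bargmann_kernel (Complex x y) t = of_real (pi powr (-3/4)) *
      (iexp (- (x * y)) * exp (of_real ((x\<^sup>2 + y\<^sup>2) / 2)) * iexp (sqrt 2 * y * t)
        * exp (of_real (- (t - sqrt 2 * x)\<^sup>2 / 2)))"
      unfolding bargmann_kernel_def by (simp only: exp_add)
    then show ?thesis
      by (simp only: exp_of_real of_real_mult mult_ac)
  qed
  then show ?thesis
    unfolding bargmann_def by (simp only: integral_mult_right_zero)
qed

lemma integrable_translated_gaussian_mult: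
  assumes g: "gauss_exp_integrable g"
  shows "integrable lborel (\<lambda>t. exp (- (t - c)\<^sup>2 / 2) * g t)"
proof -
  have I: "integrable lborel (\<lambda>t. exp (a * \<bar>t\<bar>) * (exp (- t\<^sup>2 / 2) * g t))" for a
    using g unfolding gauss_exp_integrable_def exp_integrable_def by blast
  \<comment> \<open>Measurability of \<open>g\<close> is recovered by multiplying the Gaussian back
    out of a product known to be integrable.\<close>
  have "(\<lambda>t. exp (t\<^sup>2 / 2) * (exp (0 * \<bar>t\<bar>) * (exp (- t\<^sup>2 / 2) * g t))) \<in> borel_measurable lborel"
    by (rule borel_measurable_times[OF _ borel_measurable_integrable[OF I]]) measurable
  then have [measurable]: "g \<in> borel_measurable borel"
    by (simp add: mult.assoc[symmetric] flip: exp_add)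
  show ?thesis
  proof (rule Bochner_Integration.integrable_bound[OF I[of "\<bar>c\<bar>"]])
    have "norm (exp (- (t - c)\<^sup>2 / 2) * g t) \<le> norm (exp (\<bar>c\<bar> * \<bar>t\<bar>) * (exp (- t\<^sup>2 / 2) * g t))" for t
    proof -
      \<comment> \<open>Expanding the shifted square, only the mixed term \<open>c * t\<close> can
        grow, and the exponential weight dominates it.\<close>
      have "c * t \<le> \<bar>c\<bar> * \<bar>t\<bar>" by (metis abs_ge_self abs_mult)
      moreover have "- (t - c)\<^sup>2 / 2 = c * t - t\<^sup>2 / 2 - c\<^sup>2 / 2"
        by (simp add: power2_diff field_simps)
      ultimately have "- (t - c)\<^sup>2 / 2 \<le> \<bar>c\<bar> * \<bar>t\<bar> + - t\<^sup>2 / 2"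
        using zero_le_power2[of c] by linarith
      then have "exp (- (t - c)\<^sup>2 / 2) \<le> exp (\<bar>c\<bar> * \<bar>t\<bar>) * exp (- t\<^sup>2 / 2)"
        by (simp only: exp_le_cancel_iff exp_add[symmetric])
      then show ?thesis
        by (simp add: abs_mult mult.assoc[symmetric] mult_right_mono)
    qed
    then show "AE t in lborel. norm (exp (- (t - c)\<^sup>2 / 2) * g t) \<le> norm (exp (\<bar>c\<bar> * \<bar>t\<bar>) * (exp (- t\<^sup>2 / 2) * g t))"
      by simp
  qed measurable
qed

text \<open>For fixed \<open>x\<close> the Bessel inequality bounds the integral over
  \<open>y\<close> by the squared norm of \<open>h x\<close>. By Tonelli the integral over
  \<open>x\<close> then falls on the Gaussian alone, with a bound uniform in
  \<open>t\<close>.\<close>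

lemma bargmann_fock_integrable:
  assumes gm[measurable]: "g \<in> borel_measurable borel"
    and g2: "integrable lborel (\<lambda>t. (g t)\<^sup>2 :: real)"
  shows "integrable lborel (\<lambda>(x, y). (cmod (bargmann g (Complex x y)))\<^sup>2 * exp (- (x\<^sup>2 + y\<^sup>2)))"
proof -
  note g = gauss_exp_integrableI[OF gm g2]
  define h where "h x t = exp (- (t - sqrt 2 * x)\<^sup>2 / 2) * g t" for x t
  define H where "H x y = (\<integral>t. iexp (y * t) * of_real (h x t) \<partial>lborel)" for x y
  define C where "C = (pi powr (-3/4))\<^sup>2"
  have [measurable]: "(\<lambda>(x, t). h x t) \<in> borel_measurable (lborel \<Otimes>\<^sub>M lborel)"
    unfolding h_def by measurable
  have [measurable]: "(\<lambda>(x, y). H x y) \<in> borel_measurable (lborel \<Otimes>\<^sub>M lborel)"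
    unfolding H_def by measurable
  have eq: "(cmod (bargmann g (Complex x y)))\<^sup>2 * exp (- (x\<^sup>2 + y\<^sup>2)) = C * (cmod (H x (sqrt 2 * y)))\<^sup>2" for x y
  proof -
    have e: "(exp ((x\<^sup>2 + y\<^sup>2) / 2))\<^sup>2 * exp (- (x\<^sup>2 + y\<^sup>2)) = 1"
      by (simp flip: exp_double exp_add) (simp add: field_simps)
    have "cmod (bargmann g (Complex x y)) = pi powr (-3/4) * exp ((x\<^sup>2 + y\<^sup>2) / 2) * cmod (H x (sqrt 2 * y))"
      unfolding bargmann_conv_fourier H_def h_def norm_mult by simp
    then have "(cmod (bargmann g (Complex x y)))\<^sup>2 * exp (- (x\<^sup>2 + y\<^sup>2))
      = C * (cmod (H x (sqrt 2 * y)))\<^sup>2 * ((exp ((x\<^sup>2 + y\<^sup>2) / 2))\<^sup>2 * exp (- (x\<^sup>2 + y\<^sup>2)))"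
      by (simp add: C_def power_mult_distrib mult_ac)
    then show ?thesis unfolding e by simp
  qed
  have inner: "(\<integral>\<^sup>+y. ennreal ((cmod (H x (sqrt 2 * y)))\<^sup>2) \<partial>lborel) \<le> ennreal (2 * pi) * (\<integral>\<^sup>+t. ennreal ((h x t)\<^sup>2) \<partial>lborel)" for x
  proof -
    have "(\<integral>\<^sup>+y. ennreal ((cmod (H x y))\<^sup>2) \<partial>lborel) = ennreal (sqrt 2) * (\<integral>\<^sup>+y. ennreal ((cmod (H x (sqrt 2 * y)))\<^sup>2) \<partial>lborel)"
      using nn_integral_real_affine[of "\<lambda>y. ennreal ((cmod (H x y))\<^sup>2)" "sqrt 2" 0] by simp
    moreover have "ennreal 1 * (\<integral>\<^sup>+y. ennreal ((cmod (H x (sqrt 2 * y)))\<^sup>2) \<partial>lborel) \<le> \<dots>"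
      by (intro mult_right_mono ennreal_leI) auto
    ultimately have "(\<integral>\<^sup>+y. ennreal ((cmod (H x (sqrt 2 * y)))\<^sup>2) \<partial>lborel) \<le> (\<integral>\<^sup>+y. ennreal ((cmod (H x y))\<^sup>2) \<partial>lborel)"
      by simp
    also have "\<dots> \<le> ennreal (2 * pi) * (\<integral>\<^sup>+t. ennreal ((h x t)\<^sup>2) \<partial>lborel)"
      unfolding H_def by (rule fourier_bessel) (unfold h_def, rule integrable_translated_gaussian_mult[OF g])
    finally show ?thesis .
  qed
  have "(\<integral>\<^sup>+x. (\<integral>\<^sup>+t. ennreal ((h x t)\<^sup>2) \<partial>lborel) \<partial>lborel) = (\<integral>\<^sup>+t. (\<integral>\<^sup>+x. ennreal ((h x t)\<^sup>2) \<partial>lborel) \<partial>lborel)"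
    by (rule lborel_pair.Fubini') measurable
  also have "\<dots> \<le> (\<integral>\<^sup>+t. ennreal (sqrt (2 * pi)) * ennreal ((g t)\<^sup>2) \<partial>lborel)"
  proof (rule nn_integral_mono)
    fix t
    have "(\<integral>\<^sup>+x. ennreal ((h x t)\<^sup>2) \<partial>lborel) = (\<integral>\<^sup>+x. ennreal ((g t)\<^sup>2) * ennreal (exp (- (t - sqrt 2 * x)\<^sup>2)) \<partial>lborel)"
      unfolding h_def
      by (simp add: power_mult_distrib mult.commute flip: ennreal_mult exp_double)
    also have "\<dots> = ennreal ((g t)\<^sup>2) * (\<integral>\<^sup>+x. ennreal (exp (- (t - sqrt 2 * x)\<^sup>2)) \<partial>lborel)"
      by (rule nn_integral_cmult) measurable
    also have "\<dots> \<le> ennreal ((g t)\<^sup>2) * ennreal (sqrt (2 * pi))"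
    proof (rule mult_left_mono)
      \<comment> \<open>Translating by \<open>t / sqrt 2\<close> removes \<open>t\<close>; the
        remaining Gaussian is compared with the wider standard one, whose integral is known.\<close>
      have "(\<integral>\<^sup>+x. ennreal (exp (- (t - sqrt 2 * x)\<^sup>2)) \<partial>lborel) = (\<integral>\<^sup>+x. ennreal (exp (- (sqrt 2 * x)\<^sup>2)) \<partial>lborel)"
        using nn_integral_real_affine[of "\<lambda>x. ennreal (exp (- (t - sqrt 2 * x)\<^sup>2))" 1 "t / sqrt 2"]
        by (simp add: distrib_left)
      also have "\<dots> \<le> (\<integral>\<^sup>+x. ennreal (exp (- (x / 1)\<^sup>2 / 2)) \<partial>lborel)"
        by (intro nn_integral_mono ennreal_leI) (simp add: power_mult_distrib)
      also have "\<dots> = ennreal (sqrt (2 * pi))"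
        by (subst nn_integral_eq_integral[OF integrable_gaussian]) (auto simp: integral_gaussian[of 1, simplified])
      finally show "(\<integral>\<^sup>+x. ennreal (exp (- (t - sqrt 2 * x)\<^sup>2)) \<partial>lborel) \<le> ennreal (sqrt (2 * pi))" .
    qed simp
    finally show "(\<integral>\<^sup>+x. ennreal ((h x t)\<^sup>2) \<partial>lborel) \<le> ennreal (sqrt (2 * pi)) * ennreal ((g t)\<^sup>2)"
      by (simp only: mult.commute)
  qed
  also have "\<dots> = ennreal (sqrt (2 * pi)) * (\<integral>\<^sup>+t. ennreal ((g t)\<^sup>2) \<partial>lborel)"
    by (rule nn_integral_cmult) measurable
  also have "\<dots> < \<infinity>"
    using g2 by (subst nn_integral_eq_integral[OF g2]) (auto simp: ennreal_mult_less_top)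
  finally have fin: "(\<integral>\<^sup>+x. (\<integral>\<^sup>+t. ennreal ((h x t)\<^sup>2) \<partial>lborel) \<partial>lborel) < \<infinity>" .
  have "(\<integral>\<^sup>+p. ennreal (norm (case p of (x, y) \<Rightarrow> C * (cmod (H x (sqrt 2 * y)))\<^sup>2)) \<partial>(lborel \<Otimes>\<^sub>M lborel))
    = (\<integral>\<^sup>+x. (\<integral>\<^sup>+y. ennreal (C * (cmod (H x (sqrt 2 * y)))\<^sup>2) \<partial>lborel) \<partial>lborel)"
    by (subst lborel.nn_integral_fst[symmetric]) (auto simp: C_def abs_mult)
  also have "\<dots> = (\<integral>\<^sup>+x. ennreal C * (\<integral>\<^sup>+y. ennreal ((cmod (H x (sqrt 2 * y)))\<^sup>2) \<partial>lborel) \<partial>lborel)"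
    by (subst nn_integral_cmult[symmetric]) (auto simp: C_def ennreal_mult)
  also have "\<dots> \<le> (\<integral>\<^sup>+x. ennreal C * (ennreal (2 * pi) * (\<integral>\<^sup>+t. ennreal ((h x t)\<^sup>2) \<partial>lborel)) \<partial>lborel)"
    by (intro nn_integral_mono mult_left_mono inner) simp
  also have "\<dots> = ennreal C * (ennreal (2 * pi) * (\<integral>\<^sup>+x. (\<integral>\<^sup>+t. ennreal ((h x t)\<^sup>2) \<partial>lborel) \<partial>lborel))"
    by (subst nn_integral_cmult, measurable)+
  also have "\<dots> < \<infinity>"
    using fin by (auto simp: ennreal_mult_less_top)
  finally have "integrable (lborel \<Otimes>\<^sub>M lborel) (\<lambda>(x, y). C * (cmod (H x (sqrt 2 * y)))\<^sup>2)"
    by (intro integrableI_bounded) measurable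
  then show ?thesis
    unfolding eq lborel_prod .
qed

text \<open>On the imaginary axis the Gaussian in the Fourier form is not shifted, so the values
  there determine one Fourier transform at all frequencies.\<close>

lemma bargmann_eq_zero_imp_AE_zero:
  assumes g: "gauss_exp_integrable g"
    and zero: "\<And>y. bargmann g (Complex 0 y) = 0"
  shows "AE t in lborel. g t = 0"
proof -
  have "AE t in lborel. exp (- (t - 0)\<^sup>2 / 2) * g t = 0"
  proof (rule fourier_eq_zero_imp_AE_zero[OF integrable_translated_gaussian_mult[OF g]])
    fix y :: real
    show "(\<integral>t. iexp (y * t) * of_real (exp (- (t - 0)\<^sup>2 / 2) * g t) \<partial>lborel) = 0"
      using zero[of "y / sqrt 2"] unfolding bargmann_conv_fourier by simp
  qed
  then show ?thesis by simp
qed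

section \<open>Reduction of the quaternionic transform to complex ones\<close>

definition slice_embed :: "quat \<Rightarrow> complex \<Rightarrow> quat" where
  "slice_embed I z = slice_pt I (Re z) (Im z)"

lemma slice_pt_eq_embed: "slice_pt I x y = slice_embed I (Complex x y)"
  by (simp add: slice_embed_def)

lemma imag_unit_square: "I \<in> imag_units \<Longrightarrow> I * I = -1"
  by (simp add: imag_units_def power2_eq_square)

lemma norm_slice_embed:
  assumes "I \<in> imag_units"
  shows "norm (slice_embed I z) = cmod z"
proof -
  have "(Re z)\<^sup>2 + (Im z * qI I)\<^sup>2 + (Im z * qJ I)\<^sup>2 + (Im z * qK I)\<^sup>2
      = (Re z)\<^sup>2 + (Im z)\<^sup>2 * ((qI I)\<^sup>2 + (qJ I)\<^sup>2 + (qK I)\<^sup>2)"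
    by (simp add: algebra_simps)
  then show ?thesis
    using assms by (simp add: norm_quat_def slice_embed_def cmod_def imag_units_iff)
qed

lemma slice_embed_scaleR: "slice_embed I z = Re z *\<^sub>R 1 + Im z *\<^sub>R I"
  by (simp add: slice_embed_def slice_pt_def of_real_def)

lemma bounded_linear_slice_embed:
  assumes "I \<in> imag_units"
  shows "bounded_linear (slice_embed I)"
proof (rule bounded_linear_intro)
  show "norm (slice_embed I z) \<le> norm z * 1" for z
    by (simp add: norm_slice_embed[OF assms])
qed (simp_all add: slice_embed_scaleR algebra_simps)

lemma slice_embed_mult:
  assumes "I \<in> imag_units"
  shows "slice_embed I (z * w) = slice_embed I z * slice_embed I w"
  by (simp add: slice_embed_scaleR algebra_simps imag_unit_square[OF assms])

lemma slice_embed_1 [simp]: "slice_embed I 1 = 1"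
  by (simp add: slice_embed_scaleR)

lemma slice_embed_imaginary_unit [simp]: "slice_embed I \<i> = I"
  by (simp add: slice_embed_scaleR)

lemma slice_embed_of_real [simp]: "slice_embed I (of_real r) = of_real r"
  by (simp add: slice_embed_scaleR of_real_def)

lemma slice_embed_exp:
  assumes I: "I \<in> imag_units"
  shows "slice_embed I (exp z) = exp (slice_embed I z)"
proof -
  have pow: "slice_embed I (z ^ n) = slice_embed I z ^ n" for n
    by (induction n) (simp_all add: slice_embed_mult[OF I])
  show ?thesis
    unfolding exp_def
    by (subst bounded_linear.suminf[OF bounded_linear_slice_embed[OF I] summable_exp_generic])
      (simp add: linear_scale[OF bounded_linear.linear[OF bounded_linear_slice_embed[OF I]]] pow)
qed

text \<open>Both kernels are built by the same real algebra operations and \<open>exp\<close>, all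
  of which the embedding of a slice respects.\<close>

lemma SB_kernel_slice_embed:
  assumes I: "I \<in> imag_units"
  shows "SB_kernel (slice_embed I z) t = slice_embed I (bargmann_kernel z t)"
proof -
  note lin = bounded_linear.linear[OF bounded_linear_slice_embed[OF I]]
  have "slice_embed I ((-1/2) *\<^sub>R (z\<^sup>2 + of_real (t\<^sup>2)) + (sqrt 2 * t) *\<^sub>R z)
     = (-1/2) *\<^sub>R ((slice_embed I z)\<^sup>2 + of_real (t\<^sup>2)) + (sqrt 2 * t) *\<^sub>R slice_embed I z"
    by (simp only: linear_add[OF lin] linear_scale[OF lin] slice_embed_mult[OF I] slice_embed_of_real power2_eq_square)
  then show ?thesis
    unfolding SB_kernel_def bargmann_kernel_def
    by (simp only: slice_embed_mult[OF I] slice_embed_exp[OF I] slice_embed_of_real scaleR_conv_of_real)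
qed

text \<open>The basis quaternions stand on the right, so left multiplication by \<open>I\<close> in
  the Cauchy-Riemann equation acts only on the embedded holomorphic factors. There it is
  multiplication by \<open>\<i>\<close>, which makes the \<open>y\<close> derivative
  \<open>I\<close> times the \<open>x\<close> derivative.\<close>

lemma slice_regular_of_entire:
  assumes f: "\<And>I z. I \<in> imag_units \<Longrightarrow> f (slice_embed I z) = (\<Sum>b\<in>Basis. slice_embed I (F b z) * b)"
    and F: "\<And>b z. b \<in> Basis \<Longrightarrow> (F b has_field_derivative F' b z) (at z)"
    and F': "\<And>b. b \<in> Basis \<Longrightarrow> continuous_on UNIV (F' b)"
  shows "slice_regular f"
    and "\<And>I z. I \<in> imag_units \<Longrightarrow> slice_deriv f (slice_embed I z) = (\<Sum>b\<in>Basis. slice_embed I (F' b z) * b)"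
proof -
  define D where "D I z = (\<Sum>b\<in>Basis. slice_embed I (F' b z) * b)" for I z
  have chain: "((\<lambda>t. f (slice_embed I (g t))) has_vector_derivative (\<Sum>b\<in>Basis. slice_embed I (g' * F' b (g t)) * b)) (at t)"
    if I: "I \<in> imag_units" and g: "(g has_vector_derivative g') (at t)" for I g g' and t :: real
  proof -
    have "((\<lambda>t. slice_embed I (F b (g t)) * b) has_vector_derivative slice_embed I (g' * F' b (g t)) * b) (at t)"
      if "b \<in> Basis" for b
      using bounded_linear.has_vector_derivative[OF bounded_linear_mult_left
          bounded_linear.has_vector_derivative[OF bounded_linear_slice_embed[OF I]
            field_vector_diff_chain_at[OF g F[OF that]]]]
      by (simp add: o_def)
    then show ?thesis
      unfolding f[OF I] by (intro has_vector_derivative_sum)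
  qed
  have cx: "((\<lambda>t. Complex t y) has_vector_derivative 1) (at x)" for x y
    by (auto simp: has_vector_derivative_complex_iff intro!: derivative_eq_intros)
  have cy: "((\<lambda>t. Complex x t) has_vector_derivative \<i>) (at y)" for x y
    by (auto simp: has_vector_derivative_complex_iff intro!: derivative_eq_intros)
  have vx: "((\<lambda>t. f (slice_pt I t y)) has_vector_derivative D I (Complex x y)) (at x)"
    if "I \<in> imag_units" for I x y
    using chain[OF that cx[of y x]] by (simp add: slice_pt_eq_embed D_def)
  have vy: "((\<lambda>t. f (slice_pt I x t)) has_vector_derivative I * D I (Complex x y)) (at y)"
    if "I \<in> imag_units" for I x y
    using chain[OF that cy[of x y]]
    by (simp add: slice_pt_eq_embed D_def slice_embed_mult[OF that] sum_distrib_left mult.assoc)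
  have dx: "slice_dx f I x y = D I (Complex x y)" and dy: "slice_dy f I x y = I * D I (Complex x y)"
    if "I \<in> imag_units" for I x y
    unfolding slice_dx_def slice_dy_def
    using vx[OF that] vy[OF that] by (auto intro: vector_derivative_at)
  have cont: "continuous_on UNIV (\<lambda>(x, y). D I (Complex x y))" if "I \<in> imag_units" for I
    unfolding D_def case_prod_beta
    by (intro continuous_intros bounded_linear.continuous_on[OF bounded_linear_slice_embed[OF that]]
        continuous_on_compose2[OF F']) auto
  show reg: "slice_regular f"
    unfolding slice_regular_def
  proof (intro ballI conjI allI)
    fix I :: quat and x y :: real
    assume I: "I \<in> imag_units"
    show "(\<lambda>t. f (slice_pt I t y)) differentiable at x" "(\<lambda>t. f (slice_pt I x t)) differentiable at y"
      by (rule differentiableI_vector[OF vx[OF I]] differentiableI_vector[OF vy[OF I]])+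
    show "continuous_on UNIV (\<lambda>(x, y). slice_dx f I x y)"
      using cont[OF I] by (simp add: dx[OF I])
    show "continuous_on UNIV (\<lambda>(x, y). slice_dy f I x y)"
      using continuous_on_mult_left[OF cont[OF I], of I] by (simp add: dy[OF I] case_prod_beta)
    show "(1/2) *\<^sub>R (slice_dx f I x y + I * slice_dy f I x y) = 0"
      by (simp add: dx[OF I] dy[OF I] imag_unit_square[OF I] mult.assoc[symmetric])
  qed
  fix I z assume I: "I \<in> imag_units"
  have "slice_deriv f (slice_pt I (Re z) (Im z)) = (1/2) *\<^sub>R (D I z - I * (I * D I z))"
    unfolding slice_deriv_eq[OF reg I] dx[OF I] dy[OF I] by simp
  also have "\<dots> = (1/2) *\<^sub>R (2 *\<^sub>R D I z)"
    by (simp add: imag_unit_square[OF I] mult.assoc[symmetric] scaleR_2)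
  finally show "slice_deriv f (slice_embed I z) = (\<Sum>b\<in>Basis. slice_embed I (F' b z) * b)"
    by (simp add: slice_embed_def D_def)
qed

text \<open>The embedding is isometric and each basis quaternion has norm 1, so \<open>f\<close> is
  bounded by the sum of the moduli of the \<open>F b\<close>. Cauchy-Schwarz for this finite sum
  produces the factor \<open>card Basis\<close>.\<close>

lemma slice_fock_of_entire:
  assumes f: "\<And>I z. I \<in> imag_units \<Longrightarrow> f (slice_embed I z) = (\<Sum>b\<in>Basis. slice_embed I (F b z) * b)"
    and F: "\<And>b z. b \<in> Basis \<Longrightarrow> (F b has_field_derivative F' b z) (at z)"
    and F': "\<And>b. b \<in> Basis \<Longrightarrow> continuous_on UNIV (F' b)"
    and int: "\<And>b. b \<in> Basis \<Longrightarrow> integrable lborel (\<lambda>(x, y). (cmod (F b (Complex x y)))\<^sup>2 * exp (- (x\<^sup>2 + y\<^sup>2)))"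
  shows "f \<in> slice_fock"
  unfolding slice_fock_def mem_Collect_eq
proof (intro conjI ballI)
  show "slice_regular f" by (rule slice_regular_of_entire(1)[OF f F F'])
  fix I assume I: "I \<in> imag_units"
  have contF: "continuous_on UNIV (F b)" if "b \<in> Basis" for b
    by (rule DERIV_continuous_on[OF has_field_derivative_at_within[OF F[OF that]]])
  have nrm: "(norm (slice_pt I x y))\<^sup>2 = x\<^sup>2 + y\<^sup>2" for x y
    by (simp add: slice_pt_eq_embed norm_slice_embed[OF I] cmod_def)
  have "continuous_on UNIV (\<lambda>(x, y). f (slice_pt I x y))"
    unfolding slice_pt_eq_embed f[OF I] case_prod_beta
    by (intro continuous_intros bounded_linear.continuous_on[OF bounded_linear_slice_embed[OF I]]
        continuous_on_compose2[OF contF]) auto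
  then have meas: "continuous_on UNIV (\<lambda>(x, y). (norm (f (slice_pt I x y)))\<^sup>2 * exp (- (norm (slice_pt I x y))\<^sup>2))"
    unfolding nrm case_prod_beta by (intro continuous_intros)
  define L where "L = (\<lambda>(x, y). (norm (f (slice_pt I x y)))\<^sup>2 * exp (- (norm (slice_pt I x y))\<^sup>2))"
  define B where "B p = real (card (Basis :: quat set)) *
    (\<Sum>b\<in>Basis. (case p of (x, y) \<Rightarrow> (cmod (F b (Complex x y)))\<^sup>2 * exp (- (x\<^sup>2 + y\<^sup>2))))" for p
  have "integrable lborel L"
  proof (rule Bochner_Integration.integrable_bound)
    show "integrable lborel B"
      unfolding B_def by (intro integrable_mult_right Bochner_Integration.integrable_sum int)
    show "L \<in> borel_measurable lborel"
      using borel_measurable_continuous_onI[OF meas] by (simp add: L_def)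
    have bound: "(norm (f (slice_pt I x y)))\<^sup>2 \<le> (\<Sum>b\<in>Basis. (cmod (F b (Complex x y)))\<^sup>2) * card (Basis :: quat set)" for x y
    proof -
      have "norm (f (slice_pt I x y)) \<le> (\<Sum>b\<in>Basis. norm (slice_embed I (F b (Complex x y)) * b))"
        unfolding slice_pt_eq_embed f[OF I] by (rule norm_sum)
      also have "\<dots> = (\<Sum>b\<in>(Basis :: quat set). cmod (F b (Complex x y)))"
        by (simp add: norm_mult norm_slice_embed[OF I])
      finally have "(norm (f (slice_pt I x y)))\<^sup>2 \<le> (\<Sum>b\<in>(Basis :: quat set). cmod (F b (Complex x y)))\<^sup>2"
        by (intro power_mono) auto
      also have "\<dots> \<le> (\<Sum>b\<in>Basis. (cmod (F b (Complex x y)))\<^sup>2) * card (Basis :: quat set)"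
        by (rule sum_squared_le_sum_of_squares)
      finally show ?thesis .
    qed
    have "L (x, y) \<le> B (x, y)" for x y
      using mult_right_mono[OF bound[of x y] exp_ge_zero[of "- (x\<^sup>2 + y\<^sup>2)"]]
      unfolding L_def B_def prod.case nrm by (simp add: sum_distrib_left sum_distrib_right mult_ac)
    then have "L p \<le> B p" for p by (cases p) simp
    moreover have "0 \<le> L p" for p by (cases p) (simp add: L_def)
    ultimately show "AE p in lborel. norm (L p) \<le> norm (B p)"
      by (intro AE_I2) (simp add: order_trans[OF _ abs_ge_self])
  qed
  then show "integrable lborel (\<lambda>(x, y). (norm (f (slice_pt I x y)))\<^sup>2 * exp (- (norm (slice_pt I x y))\<^sup>2))"
    by (simp add: L_def)
qed

section \<open>The quaternionic transform through four complex ones\<close>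

lemma square_integrable_component:
  assumes "square_integrable f" "b \<in> Basis"
  shows "(\<lambda>t. f t \<bullet> b) \<in> borel_measurable borel" "integrable lborel (\<lambda>t. (f t \<bullet> b)\<^sup>2)"
proof -
  have [measurable]: "f \<in> borel_measurable borel" using assms by (simp add: square_integrable_def)
  show "(\<lambda>t. f t \<bullet> b) \<in> borel_measurable borel" by measurable
  show "integrable lborel (\<lambda>t. (f t \<bullet> b)\<^sup>2)"
  proof (rule Bochner_Integration.integrable_bound)
    show "integrable lborel (\<lambda>t. (norm (f t))\<^sup>2)" using assms by (simp add: square_integrable_def)
    show "AE t in lborel. norm ((f t \<bullet> b)\<^sup>2) \<le> norm ((norm (f t))\<^sup>2)"
      using Basis_le_norm[OF assms(2)] by (intro AE_I2) (simp add: abs_le_square_iff[symmetric])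
  qed measurable
qed

text \<open>\<open>SB\<close> on representatives, so that the analysis can stay clear of the
  quotient \<open>L2\<close>.\<close>

definition SB_fun :: "(real \<Rightarrow> quat) \<Rightarrow> quat \<Rightarrow> quat" where
  "SB_fun f q = (\<integral>x. SB_kernel q x * f x \<partial>lborel)"

text \<open>The coordinates of \<open>p\<close> are real and hence central: they can be drawn into
  the embedded complex factor, leaving the basis quaternion on the right.\<close>

lemma SB_kernel_mult_slice_embed:
  assumes I: "I \<in> imag_units"
  shows "SB_kernel (slice_embed I z) t * p
    = (\<Sum>b\<in>Basis. slice_embed I (bargmann_kernel z t * of_real (p \<bullet> b)) * b)"
proof -
  have "SB_kernel (slice_embed I z) t * p
    = slice_embed I (bargmann_kernel z t) * (\<Sum>b\<in>Basis. (p \<bullet> b) *\<^sub>R b)"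
    by (simp add: SB_kernel_slice_embed[OF I] euclidean_representation)
  then show ?thesis
    by (simp add: sum_distrib_left slice_embed_mult[OF I] mult.assoc scaleR_conv_of_real)
qed

context
  fixes f :: "real \<Rightarrow> quat"
  assumes f: "square_integrable f"
begin

lemma gauss_exp_integrable_component:
  "b \<in> Basis \<Longrightarrow> gauss_exp_integrable (\<lambda>t. f t \<bullet> b)"
  by (rule gauss_exp_integrableI[OF square_integrable_component[OF f]])

lemma integrable_slice_embed_bargmann_kernel:
  assumes "I \<in> imag_units" "b \<in> Basis"
  shows "integrable lborel (\<lambda>t. slice_embed I (bargmann_kernel z t * of_real (f t \<bullet> b)) * b)"
  by (intro integrable_mult_left integrable_bounded_linear[OF bounded_linear_slice_embed]
      integrable_bargmann gauss_exp_integrable_component assms)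

lemma integrable_SB_kernel_mult: "integrable lborel (\<lambda>x. SB_kernel q x * f x)"
proof -
  obtain I z where "I \<in> imag_units" "q = slice_embed I z"
    using slice_pt_ex[of q] by (auto simp: slice_pt_eq_embed)
  then show ?thesis
    by (simp add: SB_kernel_mult_slice_embed integrable_slice_embed_bargmann_kernel)
qed

lemma SB_fun_slice_embed:
  assumes I: "I \<in> imag_units"
  shows "SB_fun f (slice_embed I z) = (\<Sum>b\<in>Basis. slice_embed I (bargmann (\<lambda>t. f t \<bullet> b) z) * b)"
proof -
  have "SB_fun f (slice_embed I z)
      = (\<Sum>b\<in>Basis. (\<integral>t. slice_embed I (bargmann_kernel z t * of_real (f t \<bullet> b)) * b \<partial>lborel))"
    unfolding SB_fun_def SB_kernel_mult_slice_embed[OF I]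
    by (intro Bochner_Integration.integral_sum integrable_slice_embed_bargmann_kernel I)
  also have "\<dots> = (\<Sum>b\<in>Basis. slice_embed I (bargmann (\<lambda>t. f t \<bullet> b) z) * b)"
    unfolding bargmann_def
    by (intro sum.cong refl integral_bounded_linear integrable_bargmann gauss_exp_integrable_component
        bounded_linear_compose[OF bounded_linear_mult_left bounded_linear_slice_embed[OF I]])
  finally show ?thesis .
qed

lemma continuous_bargmann_derivative:
  assumes "b \<in> Basis"
  shows "continuous_on UNIV (\<lambda>z. of_real (sqrt 2) * bargmann (\<lambda>t. t * (f t \<bullet> b)) z - z * bargmann (\<lambda>t. f t \<bullet> b) z)"
  using gauss_exp_integrable_component[OF assms]
  by (intro continuous_intros continuous_on_bargmann gauss_exp_integrable_times_id)

lemma SB_fun_in_slice_fock: "SB_fun f \<in> slice_fock"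
  by (rule slice_fock_of_entire[OF SB_fun_slice_embed
        has_field_derivative_bargmann[OF gauss_exp_integrable_component]
        continuous_bargmann_derivative bargmann_fock_integrable[OF square_integrable_component[OF f]]])

lemma slice_deriv_SB_fun:
  assumes "I \<in> imag_units"
  shows "slice_deriv (SB_fun f) (slice_embed I z) = (\<Sum>b\<in>Basis. slice_embed I
    (of_real (sqrt 2) * bargmann (\<lambda>t. t * (f t \<bullet> b)) z - z * bargmann (\<lambda>t. f t \<bullet> b) z) * b)"
  by (rule slice_regular_of_entire(2)[OF SB_fun_slice_embed
        has_field_derivative_bargmann[OF gauss_exp_integrable_component]
        continuous_bargmann_derivative assms])

end

text \<open>In each component multiplication by \<open>q\<close> cancels the term
  \<open>- z * bargmann\<close> of the derivative. What is left is \<open>sqrt 2\<close> times the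
  transform of \<open>t\<close> times that component.\<close>

lemma slice_deriv_plus_mult_SB_fun:
  assumes f: "square_integrable f" and xf: "square_integrable (\<lambda>x. x *\<^sub>R f x)"
  shows "(1 / sqrt 2) *\<^sub>R slice_deriv_plus_mult (SB_fun f) q = SB_fun (\<lambda>x. x *\<^sub>R f x) q"
proof -
  obtain I z where I: "I \<in> imag_units" and q: "q = slice_embed I z"
    using slice_pt_ex[of q] by (auto simp: slice_pt_eq_embed)
  note lin = bounded_linear.linear[OF bounded_linear_slice_embed[OF I]]
  have "slice_deriv_plus_mult (SB_fun f) q
    = (\<Sum>b\<in>Basis. slice_embed I (of_real (sqrt 2) * bargmann (\<lambda>t. t * (f t \<bullet> b)) z) * b)"
    unfolding slice_deriv_plus_mult_def q SB_fun_slice_embed[OF f I] slice_deriv_SB_fun[OF f I]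
    by (simp add: linear_diff[OF lin] slice_embed_mult[OF I] left_diff_distrib sum_subtractf sum_distrib_left mult.assoc)
  also have "\<dots> = sqrt 2 *\<^sub>R SB_fun (\<lambda>x. x *\<^sub>R f x) q"
    unfolding q SB_fun_slice_embed[OF xf I] inner_scaleR_left
    by (simp add: slice_embed_mult[OF I] scaleR_conv_of_real sum_distrib_left mult.assoc)
  finally show ?thesis by simp
qed

text \<open>Left multiplication by \<open>I\<close> permutes the basis up to sign, so one value of
  the transform mixes real and imaginary parts of different components. The values at
  \<open>z\<close> and at its conjugate on the same slice separate them.\<close>

lemma SB_fun_eq_zero_imp_AE_zero:
  assumes f: "square_integrable f" and zero: "\<And>q. SB_fun f q = 0"
  shows "AE x in lborel. f x = 0"
proof -
  define I where "I = Quat 0 1 0 0"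
  have I: "I \<in> imag_units" by (simp add: I_def imag_units_iff)
  \<comment> \<open>Conjugation passes through because the components of \<open>f\<close> are real
    valued.\<close>
  have cnj: "bargmann g (cnj z) = cnj (bargmann g z)" for g z
  proof -
    have "bargmann_kernel (cnj z) t = cnj (bargmann_kernel z t)" for t
      by (simp add: bargmann_kernel_def exp_cnj)
    then show ?thesis
      unfolding bargmann_def by (subst Bochner_Integration.integral_cnj[symmetric]) simp
  qed
  have bz: "bargmann (\<lambda>t. f t \<bullet> b) z = 0" if b: "b \<in> Basis" for b z
  proof -
    let ?F = "\<lambda>b. bargmann (\<lambda>t. f t \<bullet> b) z"
    have s: "(\<Sum>b\<in>Basis. Re (?F b) *\<^sub>R b) + I * (\<Sum>b\<in>Basis. Im (?F b) *\<^sub>R b) = 0"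
      using zero[of "slice_embed I z"] unfolding SB_fun_slice_embed[OF f I]
      by (simp add: slice_embed_scaleR distrib_right sum.distrib sum_distrib_left)
    have d: "(\<Sum>b\<in>Basis. Re (?F b) *\<^sub>R b) - I * (\<Sum>b\<in>Basis. Im (?F b) *\<^sub>R b) = 0"
      using zero[of "slice_embed I (cnj z)"] unfolding SB_fun_slice_embed[OF f I] cnj
      by (simp add: slice_embed_scaleR left_diff_distrib sum_subtractf sum_distrib_left)
    \<comment> \<open>Adding the two relations isolates the real parts; \<open>I\<close> is
      invertible, so the imaginary parts vanish as well.\<close>
    have "2 *\<^sub>R (\<Sum>b\<in>Basis. Re (?F b) *\<^sub>R b) = 0"
      using s d by (simp add: scaleR_2)
    then have re: "(\<Sum>b\<in>Basis. Re (?F b) *\<^sub>R b) = 0" by simp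
    have "I \<noteq> 0" by (simp add: I_def quat_eq_iff)
    then have im: "(\<Sum>b\<in>Basis. Im (?F b) *\<^sub>R b) = 0" using s re by simp
    have "Re (?F b) = 0" "Im (?F b) = 0"
      using inner_sum_left_Basis[OF b, of "\<lambda>b. Re (?F b)"] inner_sum_left_Basis[OF b, of "\<lambda>b. Im (?F b)"] re im
      by simp_all
    then show ?thesis by (simp add: complex_eq_iff)
  qed
  have "AE x in lborel. \<forall>b\<in>Basis. f x \<bullet> b = 0"
    by (intro AE_finite_allI bargmann_eq_zero_imp_AE_zero gauss_exp_integrable_component[OF f] bz) auto
  then show ?thesis by eventually_elim (simp add: euclidean_all_zero_iff)
qed

section \<open>Passage to classes in \<open>L2\<close>\<close>

lemma square_integrable_diff:
  assumes "square_integrable f" "square_integrable g"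
  shows "square_integrable (\<lambda>x. f x - g x)"
proof -
  have [measurable]: "f \<in> borel_measurable borel" "g \<in> borel_measurable borel"
    using assms by (auto simp: square_integrable_def)
  have "integrable lborel (\<lambda>x. (norm (f x - g x))\<^sup>2)"
  proof (rule Bochner_Integration.integrable_bound)
    show "integrable lborel (\<lambda>x. 2 * (norm (f x))\<^sup>2 + 2 * (norm (g x))\<^sup>2)"
      using assms by (auto simp: square_integrable_def)
    have "(norm (f x - g x))\<^sup>2 \<le> 2 * (norm (f x))\<^sup>2 + 2 * (norm (g x))\<^sup>2" for x
    proof -
      have "(norm (f x - g x))\<^sup>2 \<le> (norm (f x) + norm (g x))\<^sup>2"
        by (intro power_mono norm_triangle_ineq4) simp
      also have "\<dots> \<le> 2 * (norm (f x))\<^sup>2 + 2 * (norm (g x))\<^sup>2"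
        using sum_squares_bound[of "norm (f x)" "norm (g x)"] by (simp add: power2_sum)
      finally show ?thesis .
    qed
    then show "AE x in lborel. norm ((norm (f x - g x))\<^sup>2) \<le> norm (2 * (norm (f x))\<^sup>2 + 2 * (norm (g x))\<^sup>2)"
      by simp
  qed measurable
  then show ?thesis by (simp add: square_integrable_def)
qed

lemma L2_cases:
  obtains f where "square_integrable f" "\<phi> = abs_L2 f"
proof
  have "L2_rel (rep_L2 \<phi>) (rep_L2 \<phi>)" by (rule Quotient3_rep_reflp[OF Quotient3_L2])
  then show "square_integrable (rep_L2 \<phi>)" by (simp add: L2_rel_def)
  show "\<phi> = abs_L2 (rep_L2 \<phi>)" by (simp add: Quotient3_abs_rep[OF Quotient3_L2])
qed

lemma L2_rel_refl: "square_integrable f \<Longrightarrow> L2_rel f f"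
  by (simp add: L2_rel_def)

lemma SB_abs_L2: "square_integrable f \<Longrightarrow> SB (abs_L2 f) = SB_fun f"
  by (rule ext) (simp add: SB.abs_eq L2_rel_refl SB_fun_def)

text \<open>Makes \<open>inv SB\<close> in the theorem a true inverse on the range of
  \<open>SB\<close>. The transform is linear on representatives, so it suffices that a difference
  with zero transform vanishes almost everywhere.\<close>

lemma inj_SB: "inj SB"
proof (rule injI)
  fix \<phi> \<psi> :: L2
  assume eq: "SB \<phi> = SB \<psi>"
  obtain f where f: "square_integrable f" "\<phi> = abs_L2 f" by (rule L2_cases)
  obtain g where g: "square_integrable g" "\<psi> = abs_L2 g" by (rule L2_cases)
  have "SB_fun (\<lambda>x. f x - g x) q = 0" for q
    using fun_cong[OF eq, of q] f g integrable_SB_kernel_mult[OF f(1)] integrable_SB_kernel_mult[OF g(1)]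
    by (simp add: SB_abs_L2) (simp add: SB_fun_def right_diff_distrib)
  then have "AE x in lborel. f x - g x = 0"
    by (rule SB_fun_eq_zero_imp_AE_zero[OF square_integrable_diff[OF f(1) g(1)]])
  then have "L2_rel f g" using f g by (simp add: L2_rel_def)
  then show "\<phi> = \<psi>"
    using f g by (simp add: Quotient3_rel_abs[OF Quotient3_L2])
qed

theorem corollary3p7:
  fixes \<phi> :: L2
  assumes "\<phi> \<in> dom_X"
  shows "SB \<phi> \<in> slice_fock \<and>
    (\<lambda>q. (1 / sqrt 2) *\<^sub>R slice_deriv_plus_mult (SB \<phi>) q) \<in> slice_fock \<and>
    position_op \<phi> = inv SB (\<lambda>q. (1 / sqrt 2) *\<^sub>R slice_deriv_plus_mult (SB \<phi>) q)"
proof -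
  obtain f where f: "square_integrable f" "\<phi> = abs_L2 f" by (rule L2_cases)
  have xf: "square_integrable (\<lambda>x. x *\<^sub>R f x)"
    using assms f by (simp add: dom_X_def in_dom_X.abs_eq L2_rel_refl)
  \<comment> \<open>Membership in \<open>dom_X\<close> selects the first branch of the conditional
    that defines \<open>position_op\<close>.\<close>
  have X: "position_op \<phi> = abs_L2 (\<lambda>x. x *\<^sub>R f x)"
    using f xf by (simp add: position_op.abs_eq L2_rel_refl)
  \<comment> \<open>With the right-hand side recognised as a value of \<open>SB\<close>, its
    membership in the Fock space and the evaluation of \<open>inv SB\<close> both become facts about
    \<open>position_op \<phi>\<close>.\<close>
  have eq: "(\<lambda>q. (1 / sqrt 2) *\<^sub>R slice_deriv_plus_mult (SB \<phi>) q) = SB (position_op \<phi>)"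
    unfolding X SB_abs_L2[OF xf] using f
    by (simp add: SB_abs_L2 slice_deriv_plus_mult_SB_fun[OF f(1) xf])
  have fock: "SB \<phi> \<in> slice_fock" "SB (position_op \<phi>) \<in> slice_fock"
    unfolding X unfolding f(2) SB_abs_L2[OF f(1)] SB_abs_L2[OF xf]
    by (rule SB_fun_in_slice_fock[OF f(1)] SB_fun_in_slice_fock[OF xf])+
  show ?thesis
    unfolding eq inv_f_f[OF inj_SB] using fock by simp
qed

end
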